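(* Let $\mu=k^2\sup_{x\in\Omega}\int_\Omega|G(x,y)|\,dy$, and let $\nu,K$ ($K>0$) be constants, depending on $\nu_0=\|u_0\|_{C(\overline\Omega\times\partial\Omega)}$ but not on $n$, such that $\nu_n\le\nu K^n$ for all $n\ge0$, the sequence $\{\nu_n\}$ being defined by its initial value $\nu_0$ and $$\nu_{n+1}=\nu_n+\sum_{\substack{(i_1,i_2,i_3)\\ i_1+i_2+i_3=n\\ 0\le i_1,i_2,i_3\le n}}\nu_{i_1}\nu_{i_2}\nu_{i_3},\qquad n\ge0.$$ If $\phi\in C(\partial\Omega\times\partial\Omega)$ satisfies $\|\mathcal{K}_1\phi\|<r$, where the radius of convergence $r$ is given by $$r=\frac{1}{2K\mu}\left[\sqrt{16C^2+1}-4C\right],\qquad C=\max\{2,\|\mathcal{K}_1\|\,\nu K\mu\},$$ then the inverse Born series $\sum_{m=1}^\infty\mathcal{K}_m(\phi)$ converges.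
   Context: $\Omega\subset\mathbb{R}^d$, $d>2$, is a bounded domain with smooth boundary and $k>0$. $G$ is the Green's function: $\Delta_xG(x,y)+k^2G(x,y)=\delta(x-y)$ in $\Omega$, $\partial G/\partial\nu_y=0$ on $\partial\Omega$ (assumed to exist). The background field $u_0=u_0(x,s)$ is real valued, where for each source label $s\in\partial\Omega$ (in the paper, the position of a point source) $u_0(\cdot,s)$ solves $\Delta u_0+k^2u_0=0$ in $\Omega$ with Neumann data $\partial u_0/\partial\nu=g$ given by that source; it is assumed that $u_0\in C(\overline\Omega\times\partial\Omega)$. A multilinear operator of order $l$ is an $l$-linear map $T_l:([L^\infty(\Omega)]^2)^l\to C(\overline\Omega\times\partial\Omega)$; order-zero operators are elements of $C(\overline\Omega\times\partial\Omega)$. Arguments are pairs $\zeta=(\alpha,\beta)$, with norm $\|\zeta\|=\max(\|\alpha\|_\infty,\|\beta\|_\infty)$. For $v\in C(\overline\Omega\times\partial\Omega)$ set $a(v,\zeta)(x,s)=-k^2\int_\Omega G(x,y)\alpha(y)v(y,s)\,dy$ and $b(v,\zeta)(x,s)=-k^2\int_\Omega G(x,y)\beta(y)v(y,s)\,dy$. For $T_l$ of order $l$, define operators of order $l+1$ by $AT_l(\zeta_1,\dots,\zeta_{l+1})=a(T_l(\zeta_1,\dots,\zeta_l),\zeta_{l+1})$ and $BT_l(\zeta_1,\dots,\zeta_{l+1})=b(T_l(\zeta_1,\dots,\zeta_l),\zeta_{l+1})$. The tensor product is the pointwise product $T_l\otimes T_j(\zeta_1,\dots,\zeta_{l+j})=T_l(\zeta_1,\dots,\zeta_l)T_j(\zeta_{l+1},\dots,\zeta_{l+j})$.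 The forward operators are defined by $K_0=u_0$ and, for $n\ge0$, $$K_{n+1}=AK_n+B\sum_{\substack{(i_1,i_2,i_3)\\ i_1+i_2+i_3=n\\ 0\le i_1,i_2,i_3\le n}}K_{i_1}\otimes K_{i_2}\otimes K_{i_3}$$ ($B$ applied to the whole sum), so $K_n$ has order $n$. For the inverse problem the $K_n$ are restricted to measurement points $x\in\partial\Omega$, i.e. regarded as maps $([L^\infty(\Omega)]^2)^n\to C(\partial\Omega\times\partial\Omega)$ (with sup norm). $\mathcal{K}_1=K_1^+:C(\partial\Omega\times\partial\Omega)\to[L^\infty(\Omega)]^2$ is a fixed bounded linear operator, a regularized pseudoinverse of $K_1$ (no particular regularization is prescribed), with operator norm $\|\mathcal{K}_1\|$. The inverse operators for $m\ge2$ are defined recursively by $$\mathcal{K}_m(\phi)=-\sum_{n=2}^m\ \sum_{i_1+\cdots+i_n=m}\mathcal{K}_1\left(K_n(\mathcal{K}_{i_1}(\phi),\dots,\mathcal{K}_{i_n}(\phi))\right),$$ the inner sum running over $n$-tuples of positive integers. Convergence of the inverse Born series means convergence in $[L^\infty(\Omega)]^2$. *)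

theory Defs
  imports
    "HOL-Analysis.Analysis"
    "HOL-Probability.Essential_Supremum"
    "HOL-Library.Function_Algebras"
begin

subsection \<open>Smooth functions and smooth domains\<close>

text \<open>\<open>Ck_on n S f\<close> is meant for open \<open>S\<close>.\<close>

primrec Ck_on :: "nat \<Rightarrow> 'a::euclidean_space set \<Rightarrow> ('a \<Rightarrow> real) \<Rightarrow> bool" where
  "Ck_on 0 S f \<longleftrightarrow> continuous_on S f"
| "Ck_on (Suc n) S f \<longleftrightarrow>
     f differentiable_on S \<and> (\<forall>b\<in>Basis. Ck_on n S (\<lambda>x. frechet_derivative f (at x) b))"

definition smooth_on :: "'a::euclidean_space set \<Rightarrow> ('a \<Rightarrow> real) \<Rightarrow> bool" where
  "smooth_on S f \<longleftrightarrow> (\<forall>n. Ck_on n S f)"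

definition laplacian :: "('a::euclidean_space \<Rightarrow> real) \<Rightarrow> 'a \<Rightarrow> real" where
  "laplacian f x =
     (\<Sum>b\<in>Basis. frechet_derivative (\<lambda>z. frechet_derivative f (at z) b) (at x) b)"

text \<open>A local defining function of \<open>\<Omega>\<close> on \<open>U\<close>: smooth, without critical points, and negative exactly
  in \<open>\<Omega>\<close>. By the implicit function theorem this amounts to \<open>\<Omega> \<inter> U\<close> being, locally, one side of a
  smooth graph.\<close>

definition defining_function ::
  "'a::euclidean_space set \<Rightarrow> 'a set \<Rightarrow> ('a \<Rightarrow> real) \<Rightarrow> bool" where
  "defining_function \<Omega> U \<rho> \<longleftrightarrow>
     open U \<and> smooth_on U \<rho> \<and> (\<forall>x\<in>U. frechet_derivative \<rho> (at x) \<noteq> (\<lambda>_. 0)) \<and>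
     \<Omega> \<inter> U = {x \<in> U. \<rho> x < 0}"

definition smooth_bounded_domain :: "'a::euclidean_space set \<Rightarrow> bool" where
  "smooth_bounded_domain \<Omega> \<longleftrightarrow>
     open \<Omega> \<and> connected \<Omega> \<and> bounded \<Omega> \<and> \<Omega> \<noteq> {} \<and>
     (\<forall>p\<in>frontier \<Omega>. \<exists>U \<rho>. p \<in> U \<and> defining_function \<Omega> U \<rho>)"

definition outward_unit_normal :: "'a::euclidean_space set \<Rightarrow> 'a \<Rightarrow> 'a \<Rightarrow> bool" where
  "outward_unit_normal \<Omega> p n \<longleftrightarrow>
     (\<exists>U \<rho> D. p \<in> U \<and> defining_function \<Omega> U \<rho> \<and> (GDERIV \<rho> p :> D) \<and> n = sgn D)"

text \<open>The normal derivative of a function on the closure of \<open>\<Omega>\<close> is taken one-sidedly, from within \<open>\<Omega>\<close>.\<close>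

definition has_normal_derivative ::
  "'a::euclidean_space set \<Rightarrow> ('a \<Rightarrow> real) \<Rightarrow> real \<Rightarrow> 'a \<Rightarrow> bool" where
  "has_normal_derivative \<Omega> f D p \<longleftrightarrow>
     (\<exists>n. outward_unit_normal \<Omega> p n \<and>
          ((\<lambda>t. f (p - t *\<^sub>R n)) has_real_derivative (- D)) (at 0 within {0..}))"

subsection \<open>Function spaces\<close>

text \<open>Elements of \<open>L\<^sup>\<infinity>(\<Omega>)\<close> are represented by functions; they are identified when they agree almost
  everywhere on \<open>\<Omega>\<close>, and values outside \<open>\<Omega>\<close> are irrelevant.\<close>

definition Linf :: "'a::euclidean_space set \<Rightarrow> ('a \<Rightarrow> real) set" where
  "Linf \<Omega> = {f \<in> borel_measurable (lebesgue_on \<Omega>).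
               esssup (lebesgue_on \<Omega>) (\<lambda>x. ereal \<bar>f x\<bar>) < \<infinity>}"

definition Linf_norm :: "'a::euclidean_space set \<Rightarrow> ('a \<Rightarrow> real) \<Rightarrow> real" where
  "Linf_norm \<Omega> f = real_of_ereal (esssup (lebesgue_on \<Omega>) (\<lambda>x. ereal \<bar>f x\<bar>))"

type_synonym 'a coeff = "('a \<Rightarrow> real) \<times> ('a \<Rightarrow> real)"

abbreviation Linf2 :: "'a::euclidean_space set \<Rightarrow> 'a coeff set" where
  "Linf2 \<Omega> \<equiv> Linf \<Omega> \<times> Linf \<Omega>"

definition Linf2_norm :: "'a::euclidean_space set \<Rightarrow> 'a coeff \<Rightarrow> real" where
  "Linf2_norm \<Omega> \<zeta> = max (Linf_norm \<Omega> (fst \<zeta>)) (Linf_norm \<Omega> (snd \<zeta>))"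

text \<open>\<open>C(X)\<close> for compact \<open>X\<close>; only the values on \<open>X\<close> matter.\<close>

definition Cont :: "'b::topological_space set \<Rightarrow> ('b \<Rightarrow> real) set" where
  "Cont X = {f. continuous_on X f}"

definition sup_norm :: "'b set \<Rightarrow> ('b \<Rightarrow> real) \<Rightarrow> real" where
  "sup_norm X f = (SUP p\<in>X. \<bar>f p\<bar>)"

abbreviation field_dom :: "'a::euclidean_space set \<Rightarrow> ('a \<times> 'a) set" where
  "field_dom \<Omega> \<equiv> closure \<Omega> \<times> frontier \<Omega>"

abbreviation data_dom :: "'a::euclidean_space set \<Rightarrow> ('a \<times> 'a) set" where
  "data_dom \<Omega> \<equiv> frontier \<Omega> \<times> frontier \<Omega>"

subsection \<open>Green's function and background field\<close>

definition test_function :: "'a::euclidean_space set \<Rightarrow> ('a \<Rightarrow> real) \<Rightarrow> bool" where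
  "test_function \<Omega> \<psi> \<longleftrightarrow>
     smooth_on UNIV \<psi> \<and> compact (closure {x. \<psi> x \<noteq> 0}) \<and> closure {x. \<psi> x \<noteq> 0} \<subseteq> \<Omega>"

text \<open>The equation \<open>\<Delta>\<^sub>x G(x,y) + k\<^sup>2 G(x,y) = \<delta>(x - y)\<close> is read in the sense of distributions on \<open>\<Omega>\<close>,
  the condition \<open>\<partial>G/\<partial>\<nu>\<^sub>y = 0\<close> pointwise for \<open>y\<close> on the boundary.\<close>

definition neumann_green_function ::
  "real \<Rightarrow> 'a::euclidean_space set \<Rightarrow> ('a \<Rightarrow> 'a \<Rightarrow> real) \<Rightarrow> bool" where
  "neumann_green_function k \<Omega> G \<longleftrightarrow>
     (\<forall>y\<in>\<Omega>. \<forall>\<psi>. test_function \<Omega> \<psi> \<longrightarrow>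
        has_bochner_integral (lebesgue_on \<Omega>) (\<lambda>x. G x y * (laplacian \<psi> x + k\<^sup>2 * \<psi> x)) (\<psi> y)) \<and>
     (\<forall>x\<in>\<Omega>. \<forall>y\<in>frontier \<Omega>. has_normal_derivative \<Omega> (G x) 0 y)"

text \<open>What makes \<open>\<mu>\<close> and the integral operators \<open>a\<close>, \<open>b\<close> below well defined: \<open>G(x,\<cdot>)\<close> is integrable,
  with bounded integrals, and integration against \<open>G\<close> maps \<open>L\<^sup>\<infinity>(\<Omega>)\<close> to continuous functions on the
  closure of \<open>\<Omega>\<close>.\<close>

definition admissible_kernel ::
  "'a::euclidean_space set \<Rightarrow> ('a \<Rightarrow> 'a \<Rightarrow> real) \<Rightarrow> bool" where
  "admissible_kernel \<Omega> G \<longleftrightarrow>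
     (\<forall>x\<in>closure \<Omega>. integrable (lebesgue_on \<Omega>) (G x)) \<and>
     bdd_above ((\<lambda>x. LINT y|lebesgue_on \<Omega>. \<bar>G x y\<bar>) ` \<Omega>) \<and>
     (\<forall>f\<in>Linf \<Omega>. continuous_on (closure \<Omega>) (\<lambda>x. LINT y|lebesgue_on \<Omega>. G x y * f y))"

definition background_field ::
  "real \<Rightarrow> 'a::euclidean_space set \<Rightarrow> ('a \<times> 'a \<Rightarrow> real) \<Rightarrow> ('a \<times> 'a \<Rightarrow> real) \<Rightarrow> bool" where
  "background_field k \<Omega> g u\<^sub>0 \<longleftrightarrow>
     u\<^sub>0 \<in> Cont (field_dom \<Omega>) \<and>
     (\<forall>s\<in>frontier \<Omega>.
        Ck_on 2 \<Omega> (\<lambda>x. u\<^sub>0 (x, s)) \<and>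
        (\<forall>x\<in>\<Omega>. laplacian (\<lambda>z. u\<^sub>0 (z, s)) x + k\<^sup>2 * u\<^sub>0 (x, s) = 0) \<and>
        (\<forall>x\<in>frontier \<Omega>. has_normal_derivative \<Omega> (\<lambda>z. u\<^sub>0 (z, s)) (g (x, s)) x))"

subsection \<open>Forward operators\<close>

text \<open>An operator of order \<open>l\<close> is a function on argument lists, of which only the values on lists of
  length \<open>l\<close> matter. Addition of operators is pointwise.\<close>

type_synonym 'a field_op = "'a coeff list \<Rightarrow> 'a \<times> 'a \<Rightarrow> real"

definition a_map ::
  "real \<Rightarrow> 'a::euclidean_space set \<Rightarrow> ('a \<Rightarrow> 'a \<Rightarrow> real) \<Rightarrow> ('a \<times> 'a \<Rightarrow> real) \<Rightarrow> 'a coeff \<Rightarrow> 'a \<times> 'a \<Rightarrow> real"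
  where "a_map k \<Omega> G v \<zeta> =
    (\<lambda>(x, s). - k\<^sup>2 * (LINT y|lebesgue_on \<Omega>. G x y * fst \<zeta> y * v (y, s)))"

definition b_map ::
  "real \<Rightarrow> 'a::euclidean_space set \<Rightarrow> ('a \<Rightarrow> 'a \<Rightarrow> real) \<Rightarrow> ('a \<times> 'a \<Rightarrow> real) \<Rightarrow> 'a coeff \<Rightarrow> 'a \<times> 'a \<Rightarrow> real"
  where "b_map k \<Omega> G v \<zeta> =
    (\<lambda>(x, s). - k\<^sup>2 * (LINT y|lebesgue_on \<Omega>. G x y * snd \<zeta> y * v (y, s)))"

definition op_A ::
  "real \<Rightarrow> 'a::euclidean_space set \<Rightarrow> ('a \<Rightarrow> 'a \<Rightarrow> real) \<Rightarrow> 'a field_op \<Rightarrow> 'a field_op" where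
  "op_A k \<Omega> G T = (\<lambda>\<zeta>s. a_map k \<Omega> G (T (butlast \<zeta>s)) (last \<zeta>s))"

definition op_B ::
  "real \<Rightarrow> 'a::euclidean_space set \<Rightarrow> ('a \<Rightarrow> 'a \<Rightarrow> real) \<Rightarrow> 'a field_op \<Rightarrow> 'a field_op" where
  "op_B k \<Omega> G T = (\<lambda>\<zeta>s. b_map k \<Omega> G (T (butlast \<zeta>s)) (last \<zeta>s))"

text \<open>Tensor product of an operator \<open>T\<close> of order \<open>l\<close> with an operator \<open>S\<close>.\<close>

definition tensor :: "nat \<Rightarrow> 'a field_op \<Rightarrow> 'a field_op \<Rightarrow> 'a field_op" where
  "tensor l T S = (\<lambda>\<zeta>s p. T (take l \<zeta>s) p * S (drop l \<zeta>s) p)"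

definition triples :: "nat \<Rightarrow> (nat \<times> nat \<times> nat) set" where
  "triples n = {(i1, i2, i3). i1 + i2 + i3 = n}"

function forward_op ::
  "real \<Rightarrow> 'a::euclidean_space set \<Rightarrow> ('a \<Rightarrow> 'a \<Rightarrow> real) \<Rightarrow> ('a \<times> 'a \<Rightarrow> real) \<Rightarrow> nat \<Rightarrow> 'a field_op"
  where
  "forward_op k \<Omega> G u\<^sub>0 0 = (\<lambda>_. u\<^sub>0)"
| "forward_op k \<Omega> G u\<^sub>0 (Suc n) =
     op_A k \<Omega> G (forward_op k \<Omega> G u\<^sub>0 n) +
     op_B k \<Omega> G (\<Sum>(i1, i2, i3)\<in>triples n.
       tensor (i1 + i2) (tensor i1 (forward_op k \<Omega> G u\<^sub>0 i1) (forward_op k \<Omega> G u\<^sub>0 i2))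
         (forward_op k \<Omega> G u\<^sub>0 i3))"
  by pat_completeness auto
termination
  by (relation "Wellfounded.measure (\<lambda>(k, \<Omega>, G, u, n). n)") (auto simp: triples_def)

function bound_seq :: "real \<Rightarrow> nat \<Rightarrow> real" where
  "bound_seq c 0 = c"
| "bound_seq c (Suc n) = bound_seq c n +
     (\<Sum>(i1, i2, i3)\<in>triples n. bound_seq c i1 * bound_seq c i2 * bound_seq c i3)"
  by pat_completeness auto
termination
  by (relation "Wellfounded.measure (\<lambda>(c, n). n)") (auto simp: triples_def)

subsection \<open>Inverse operators\<close>

text \<open>Bounded linear operators from \<open>C(\<partial>\<Omega> \<times> \<partial>\<Omega>)\<close> to \<open>[L\<^sup>\<infinity>(\<Omega>)]\<^sup>2\<close>, linearity being understood almost
  everywhere. Linearity and boundedness force the value (as an element of \<open>[L\<^sup>\<infinity>(\<Omega>)]\<^sup>2\<close>) to depend only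
  on the restriction of the argument to \<open>\<partial>\<Omega> \<times> \<partial>\<Omega>\<close>.\<close>

definition bounded_linear_data_op ::
  "'a::euclidean_space set \<Rightarrow> (('a \<times> 'a \<Rightarrow> real) \<Rightarrow> 'a coeff) \<Rightarrow> bool" where
  "bounded_linear_data_op \<Omega> L \<longleftrightarrow>
     L ` Cont (data_dom \<Omega>) \<subseteq> Linf2 \<Omega> \<and>
     (\<forall>\<phi>\<in>Cont (data_dom \<Omega>). \<forall>\<psi>\<in>Cont (data_dom \<Omega>).
        AE x in lebesgue_on \<Omega>.
          fst (L (\<phi> + \<psi>)) x = fst (L \<phi>) x + fst (L \<psi>) x \<and>
          snd (L (\<phi> + \<psi>)) x = snd (L \<phi>) x + snd (L \<psi>) x) \<and>
     (\<forall>\<phi>\<in>Cont (data_dom \<Omega>). \<forall>c::real.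
        AE x in lebesgue_on \<Omega>.
          fst (L (\<lambda>p. c * \<phi> p)) x = c * fst (L \<phi>) x \<and>
          snd (L (\<lambda>p. c * \<phi> p)) x = c * snd (L \<phi>) x) \<and>
     (\<exists>M. \<forall>\<phi>\<in>Cont (data_dom \<Omega>). Linf2_norm \<Omega> (L \<phi>) \<le> M * sup_norm (data_dom \<Omega>) \<phi>)"

definition data_op_norm ::
  "'a::euclidean_space set \<Rightarrow> (('a \<times> 'a \<Rightarrow> real) \<Rightarrow> 'a coeff) \<Rightarrow> real" where
  "data_op_norm \<Omega> L =
     (SUP \<phi>\<in>Cont (data_dom \<Omega>). Linf2_norm \<Omega> (L \<phi>) / sup_norm (data_dom \<Omega>) \<phi>)"

text \<open>Ordered \<open>n\<close>-tuples of positive integers with sum \<open>m\<close>.\<close>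

definition compositions :: "nat \<Rightarrow> nat \<Rightarrow> nat list set" where
  "compositions n m = {is. length is = n \<and> sum_list is = m \<and> (\<forall>i\<in>set is. 0 < i)}"

lemma compositions_less:
  assumes "is \<in> compositions n m" "2 \<le> n" "i \<in> set is"
  shows "i < m"
proof -
  obtain xs ys where is_eq: "is = xs @ i # ys"
    using assms(3) by (meson split_list)
  have "xs @ ys \<noteq> []"
    using assms(1,2) is_eq by (auto simp: compositions_def)
  then obtain j where "j \<in> set (xs @ ys)"
    by (meson ex_in_conv set_empty)
  moreover from this have "0 < j"
    using assms(1) is_eq by (auto simp: compositions_def)
  ultimately have "0 < sum_list (xs @ ys)"
    using member_le_sum_list[of j "xs @ ys"] by linarith
  then show ?thesis
    using assms(1) is_eq by (auto simp: compositions_def)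
qed

text \<open>\<open>inverse_op F L m\<close> is built from the forward operators \<open>F n\<close> and from \<open>L\<close> (the operator
  for \<open>m = 1\<close>). The restriction of \<open>F n\<close> to boundary points is implicit, since \<open>L\<close> only sees
  boundary values.\<close>

function inverse_op ::
  "(nat \<Rightarrow> 'a field_op) \<Rightarrow> (('a \<times> 'a \<Rightarrow> real) \<Rightarrow> 'a coeff) \<Rightarrow> nat \<Rightarrow> ('a \<times> 'a \<Rightarrow> real) \<Rightarrow> 'a coeff"
  where
  "inverse_op F L m \<phi> =
     (if m = 0 then 0
      else if m = 1 then L \<phi>
      else - (\<Sum>n=2..m. \<Sum>is\<in>compositions n m. L (F n (map (\<lambda>i. inverse_op F L i \<phi>) is))))"
  by pat_completeness auto
termination
  by (relation "Wellfounded.measure (\<lambda>(F, L, m, \<phi>). m)") (auto intro: compositions_less)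

declare inverse_op.simps [simp del]

end

theory Submission
  imports Defs
begin

text \<open>The forward operators satisfy \<open>\<bar>K\<^sub>n(\<zeta>\<^sub>1,\<dots>,\<zeta>\<^sub>n)\<bar> \<le> \<nu>\<^sub>n \<mu>\<^sup>n \<Prod>\<^sub>i \<parallel>\<zeta>\<^sub>i\<parallel>\<close>, because one
  integration against \<open>G\<close> costs a factor \<open>\<mu>\<close> and the recursion of \<open>\<nu>\<^sub>n\<close> copies that of \<open>K\<^sub>n\<close>.
  Hence the norms \<open>b\<^sub>m\<close> of the terms of the inverse series satisfy
  \<open>b\<^sub>m \<le> M \<Sum>\<^sub>n c\<^sup>n \<Sum> b(i\<^sub>1) \<cdots> b(i\<^sub>n)\<close> over compositions of \<open>m\<close> into \<open>n \<ge> 2\<close> parts, with \<open>c = K \<mu>\<close>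
  and \<open>M = \<parallel>\<K>\<^sub>1\<parallel> \<nu>\<close>. For \<open>b\<^sub>1 < r\<close> the partial sums of \<open>b\<^sub>m\<close> stay below \<open>2 b\<^sub>1\<close>, so the series
  converges absolutely.\<close>

subsection \<open>The norm of \<open>L\<^sup>\<infinity>\<close>\<close>

text \<open>The bound by the extended real essential supremum always holds; it remains to pass to
  its real value. Membership in \<open>Linf\<close> excludes \<infinity>, and for the value
  -\<infinity> the bound is false at every point, so that case is vacuous.\<close>

lemma AE_abs_le_Linf_norm:
  assumes "f \<in> Linf \<Omega>"
  shows "AE x in lebesgue_on \<Omega>. \<bar>f x\<bar> \<le> Linf_norm \<Omega> f"
proof -
  have *: "esssup (lebesgue_on \<Omega>) (\<lambda>x. ereal \<bar>f x\<bar>) < \<infinity>"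
    using assms by (simp add: Linf_def)
  have "AE x in lebesgue_on \<Omega>. ereal \<bar>f x\<bar> \<le> esssup (lebesgue_on \<Omega>) (\<lambda>x. ereal \<bar>f x\<bar>)"
    by (rule esssup_AE)
  then show ?thesis
    by eventually_elim
      (use * in \<open>cases "esssup (lebesgue_on \<Omega>) (\<lambda>x. ereal \<bar>f x\<bar>)"; auto simp: Linf_norm_def\<close>)
qed

text \<open>The hypothesis \<open>0 \<le> c\<close> handles an essential supremum of -\<infinity>,
  where \<open>real_of_ereal\<close> makes the norm 0.\<close>

lemma
  assumes "f \<in> borel_measurable (lebesgue_on \<Omega>)" "AE x in lebesgue_on \<Omega>. \<bar>f x\<bar> \<le> c" "0 \<le> c"
  shows LinfI: "f \<in> Linf \<Omega>" and Linf_norm_le: "Linf_norm \<Omega> f \<le> c"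
proof -
  have *: "esssup (lebesgue_on \<Omega>) (\<lambda>x. ereal \<bar>f x\<bar>) \<le> ereal c"
    using assms by (intro esssup_I) auto
  then show "f \<in> Linf \<Omega>"
    using assms(1) by (auto simp: Linf_def intro: le_less_trans)
  show "Linf_norm \<Omega> f \<le> c"
    using * assms(3) by (cases "esssup (lebesgue_on \<Omega>) (\<lambda>x. ereal \<bar>f x\<bar>)") (auto simp: Linf_norm_def)
qed

lemma Linf_norm_nonneg:
  assumes "f \<in> Linf \<Omega>"
  shows "0 \<le> Linf_norm \<Omega> f"
proof (rule ccontr)
  assume neg: "\<not> 0 \<le> Linf_norm \<Omega> f"
  have "AE x in lebesgue_on \<Omega>. \<bar>f x\<bar> \<le> Linf_norm \<Omega> f"
    by (rule AE_abs_le_Linf_norm[OF assms])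
  \<comment> \<open>A negative bound on an absolute value fails at every point, so this
    almost-everywhere statement implies any other. The essential supremum is then -\<infinity>,
    whose real value 0 is not negative after all.\<close>
  then have "AE x in lebesgue_on \<Omega>. ereal \<bar>f x\<bar> \<le> - \<infinity>"
    by eventually_elim (use neg in auto)
  then have "esssup (lebesgue_on \<Omega>) (\<lambda>x. ereal \<bar>f x\<bar>) \<le> - \<infinity>"
    using assms by (intro esssup_I) (auto simp: Linf_def)
  then show False
    using neg by (simp add: Linf_norm_def)
qed

lemma Linf2_norm_nonneg: "\<zeta> \<in> Linf2 \<Omega> \<Longrightarrow> 0 \<le> Linf2_norm \<Omega> \<zeta>"
  by (auto simp: Linf2_norm_def le_max_iff_disj Linf_norm_nonneg)

lemma AE_abs_le_Linf2_norm:
  assumes "\<zeta> \<in> Linf2 \<Omega>"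
  shows "AE x in lebesgue_on \<Omega>. \<bar>fst \<zeta> x\<bar> \<le> Linf2_norm \<Omega> \<zeta> \<and> \<bar>snd \<zeta> x\<bar> \<le> Linf2_norm \<Omega> \<zeta>"
proof -
  have "fst \<zeta> \<in> Linf \<Omega>" "snd \<zeta> \<in> Linf \<Omega>"
    using assms by auto
  from this[THEN AE_abs_le_Linf_norm] show ?thesis
    by eventually_elim (auto simp: Linf2_norm_def)
qed

lemma
  assumes "fst \<zeta> \<in> borel_measurable (lebesgue_on \<Omega>)" "snd \<zeta> \<in> borel_measurable (lebesgue_on \<Omega>)"
    and "AE x in lebesgue_on \<Omega>. \<bar>fst \<zeta> x\<bar> \<le> c \<and> \<bar>snd \<zeta> x\<bar> \<le> c" "0 \<le> c"
  shows Linf2I: "\<zeta> \<in> Linf2 \<Omega>" and Linf2_norm_le: "Linf2_norm \<Omega> \<zeta> \<le> c"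
proof -
  have ae: "AE x in lebesgue_on \<Omega>. \<bar>fst \<zeta> x\<bar> \<le> c" "AE x in lebesgue_on \<Omega>. \<bar>snd \<zeta> x\<bar> \<le> c"
    using assms(3) by (eventually_elim, simp)+
  show "\<zeta> \<in> Linf2 \<Omega>"
    using LinfI[OF assms(1) ae(1) assms(4)] LinfI[OF assms(2) ae(2) assms(4)]
    by (simp add: mem_Times_iff)
  show "Linf2_norm \<Omega> \<zeta> \<le> c"
    using Linf_norm_le[OF assms(1) ae(1) assms(4)] Linf_norm_le[OF assms(2) ae(2) assms(4)]
    by (simp add: Linf2_norm_def)
qed

lemma Linf2_measurable:
  assumes "\<zeta> \<in> Linf2 \<Omega>"
  shows "fst \<zeta> \<in> borel_measurable (lebesgue_on \<Omega>)" "snd \<zeta> \<in> borel_measurable (lebesgue_on \<Omega>)"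
  using assms by (auto simp: Linf_def)

text \<open>Takes care of the minus sign in the definition of \<open>inverse_op\<close>.\<close>

lemma
  assumes "\<zeta> \<in> Linf2 \<Omega>"
  shows uminus_in_Linf2: "- \<zeta> \<in> Linf2 \<Omega>"
    and Linf2_norm_uminus_le: "Linf2_norm \<Omega> (- \<zeta>) \<le> Linf2_norm \<Omega> \<zeta>"
proof -
  note * = Linf2_measurable[OF assms] AE_abs_le_Linf2_norm[OF assms] Linf2_norm_nonneg[OF assms]
  have "fst (- \<zeta>) \<in> borel_measurable (lebesgue_on \<Omega>)" "snd (- \<zeta>) \<in> borel_measurable (lebesgue_on \<Omega>)"
    using * by (auto simp: fun_Compl_def)
  moreover have "AE x in lebesgue_on \<Omega>. \<bar>fst (- \<zeta>) x\<bar> \<le> Linf2_norm \<Omega> \<zeta> \<and> \<bar>snd (- \<zeta>) x\<bar> \<le> Linf2_norm \<Omega> \<zeta>"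
    using *(3) by simp
  ultimately show "- \<zeta> \<in> Linf2 \<Omega>" "Linf2_norm \<Omega> (- \<zeta>) \<le> Linf2_norm \<Omega> \<zeta>"
    using *(4) by (blast intro: Linf2I, blast intro: Linf2_norm_le)
qed

lemma sum_fun_apply: "(\<Sum>i\<in>I. f i) x = (\<Sum>i\<in>I. f i x)"
  by (induction I rule: infinite_finite_induct) auto

text \<open>Finitely many exceptional null sets unite to a null set, off which the triangle
  inequality applies. Arbitrary bounds \<open>c i\<close> in place of the norms allow the estimate
  to be nested for double sums.\<close>

lemma
  assumes I: "finite I" and \<zeta>: "\<And>i. i \<in> I \<Longrightarrow> \<zeta> i \<in> Linf2 \<Omega>"
    and c: "\<And>i. i \<in> I \<Longrightarrow> Linf2_norm \<Omega> (\<zeta> i) \<le> c i"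
  shows sum_in_Linf2: "(\<Sum>i\<in>I. \<zeta> i) \<in> Linf2 \<Omega>"
    and Linf2_norm_sum_le: "Linf2_norm \<Omega> (\<Sum>i\<in>I. \<zeta> i) \<le> (\<Sum>i\<in>I. c i)"
proof -
  have fst: "fst (\<Sum>i\<in>I. \<zeta> i) = (\<lambda>x. \<Sum>i\<in>I. fst (\<zeta> i) x)"
    and snd: "snd (\<Sum>i\<in>I. \<zeta> i) = (\<lambda>x. \<Sum>i\<in>I. snd (\<zeta> i) x)"
    by (auto simp: fst_sum snd_sum sum_fun_apply)
  have "fst (\<Sum>i\<in>I. \<zeta> i) \<in> borel_measurable (lebesgue_on \<Omega>)"
    "snd (\<Sum>i\<in>I. \<zeta> i) \<in> borel_measurable (lebesgue_on \<Omega>)"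
    unfolding fst snd using Linf2_measurable[OF \<zeta>] by (auto intro!: borel_measurable_sum)
  moreover have "AE x in lebesgue_on \<Omega>. \<forall>i\<in>I. \<bar>fst (\<zeta> i) x\<bar> \<le> Linf2_norm \<Omega> (\<zeta> i) \<and> \<bar>snd (\<zeta> i) x\<bar> \<le> Linf2_norm \<Omega> (\<zeta> i)"
    using I AE_abs_le_Linf2_norm[OF \<zeta>] by (intro AE_finite_allI) auto
  then have "AE x in lebesgue_on \<Omega>. \<bar>fst (\<Sum>i\<in>I. \<zeta> i) x\<bar> \<le> (\<Sum>i\<in>I. c i) \<and> \<bar>snd (\<Sum>i\<in>I. \<zeta> i) x\<bar> \<le> (\<Sum>i\<in>I. c i)"
    unfolding fst snd
    by eventually_elim (use c in \<open>auto intro!: order_trans[OF sum_abs] sum_mono intro: order_trans\<close>)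
  moreover have "0 \<le> (\<Sum>i\<in>I. c i)"
    using c Linf2_norm_nonneg[OF \<zeta>] by (intro sum_nonneg) (auto intro: order_trans)
  ultimately show "(\<Sum>i\<in>I. \<zeta> i) \<in> Linf2 \<Omega>" "Linf2_norm \<Omega> (\<Sum>i\<in>I. \<zeta> i) \<le> (\<Sum>i\<in>I. c i)"
    by (blast intro: Linf2I, blast intro: Linf2_norm_le)
qed

text \<open>This is completeness in the form needed: off one null set the series converges
  absolutely at each point, and the tails of the norm series control the error uniformly.\<close>

lemma Linf2_series_convergent:
  assumes \<zeta>: "\<And>m. \<zeta> m \<in> Linf2 \<Omega>" and summ: "summable (\<lambda>m. Linf2_norm \<Omega> (\<zeta> m))"
  shows "\<exists>\<xi>\<in>Linf2 \<Omega>. (\<lambda>N. Linf2_norm \<Omega> ((\<Sum>m<N. \<zeta> m) - \<xi>)) \<longlonglongrightarrow> 0"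
proof -
  define b where "b m = Linf2_norm \<Omega> (\<zeta> m)" for m
  \<comment> \<open>The limit is the pointwise sum. On the exceptional null set
    \<open>suminf\<close> may be an arbitrary value.\<close>
  define \<xi> where "\<xi> = ((\<lambda>x. \<Sum>m. fst (\<zeta> m) x), (\<lambda>x. \<Sum>m. snd (\<zeta> m) x))"
  note meas = Linf2_measurable[OF \<zeta>]
  have b: "summable b" "\<And>m. 0 \<le> b m"
    using summ Linf2_norm_nonneg[OF \<zeta>] by (auto simp: b_def[abs_def])
  \<comment> \<open>Used pointwise in both components: with \<open>N = 0\<close> it shows that \<xi>
    is essentially bounded, with general \<open>N\<close> it gives the rate of convergence.\<close>
  have tail: "\<bar>suminf f - (\<Sum>m<N. f m)\<bar> \<le> (\<Sum>m. b (m + N))"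
    if "\<And>m. \<bar>f m\<bar> \<le> b m" for f :: "nat \<Rightarrow> real" and N
  proof -
    have f: "summable f"
      using that b by (intro summable_comparison_test'[of b 0 f]) auto
    have "suminf f - (\<Sum>m<N. f m) = (\<Sum>m. f (m + N))"
      using suminf_split_initial_segment[OF f, of N] by simp
    also have "\<bar>\<dots>\<bar> \<le> (\<Sum>m. b (m + N))"
      using that b summable_ignore_initial_segment[OF b(1), of N]
      by (intro norm_suminf_le[where 'a=real, simplified]) auto
    finally show ?thesis .
  qed
  have ae: "AE x in lebesgue_on \<Omega>. \<forall>m. \<bar>fst (\<zeta> m) x\<bar> \<le> b m \<and> \<bar>snd (\<zeta> m) x\<bar> \<le> b m"
    using AE_abs_le_Linf2_norm[OF \<zeta>] by (simp add: AE_all_countable b_def)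
  have \<xi>_meas: "fst \<xi> \<in> borel_measurable (lebesgue_on \<Omega>)" "snd \<xi> \<in> borel_measurable (lebesgue_on \<Omega>)"
    using meas by (auto simp: \<xi>_def)
  have "AE x in lebesgue_on \<Omega>. \<bar>fst \<xi> x\<bar> \<le> suminf b \<and> \<bar>snd \<xi> x\<bar> \<le> suminf b"
    using ae
  proof eventually_elim
    case (elim x)
    then show ?case
      using tail[of "\<lambda>m. fst (\<zeta> m) x" 0] tail[of "\<lambda>m. snd (\<zeta> m) x" 0] by (simp add: \<xi>_def)
  qed
  then have \<xi>: "\<xi> \<in> Linf2 \<Omega>"
    using b by (intro Linf2I[OF \<xi>_meas, of "suminf b"] suminf_nonneg)
  have diff: "fst ((\<Sum>m<N. \<zeta> m) - \<xi>) = (\<lambda>x. (\<Sum>m<N. fst (\<zeta> m) x) - fst \<xi> x)"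
    "snd ((\<Sum>m<N. \<zeta> m) - \<xi>) = (\<lambda>x. (\<Sum>m<N. snd (\<zeta> m) x) - snd \<xi> x)" for N
    by (auto simp: fst_sum snd_sum sum_fun_apply fun_diff_def)
  have diff_meas: "fst ((\<Sum>m<N. \<zeta> m) - \<xi>) \<in> borel_measurable (lebesgue_on \<Omega>)"
    "snd ((\<Sum>m<N. \<zeta> m) - \<xi>) \<in> borel_measurable (lebesgue_on \<Omega>)" for N
    unfolding diff using meas \<xi>_meas by auto
  have diff_ae: "AE x in lebesgue_on \<Omega>. \<bar>fst ((\<Sum>m<N. \<zeta> m) - \<xi>) x\<bar> \<le> (\<Sum>m. b (m + N)) \<and>
     \<bar>snd ((\<Sum>m<N. \<zeta> m) - \<xi>) x\<bar> \<le> (\<Sum>m. b (m + N))" for N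
    using ae
  proof eventually_elim
    case (elim x)
    then show ?case
      unfolding diff using tail[of "\<lambda>m. fst (\<zeta> m) x" N] tail[of "\<lambda>m. snd (\<zeta> m) x" N]
      by (simp add: \<xi>_def abs_minus_commute)
  qed
  have tail_nonneg: "0 \<le> (\<Sum>m. b (m + N))" for N
    using b summable_ignore_initial_segment[OF b(1), of N] by (intro suminf_nonneg) auto
  have lim: "(\<lambda>N. \<Sum>m. b (m + N)) \<longlonglongrightarrow> 0"
    by (rule suminf_exist_split2[OF b(1)])
  have "(\<lambda>N. Linf2_norm \<Omega> ((\<Sum>m<N. \<zeta> m) - \<xi>)) \<longlonglongrightarrow> 0"
  proof (rule tendsto_sandwich[OF _ _ tendsto_const lim])
    show "\<forall>\<^sub>F N in sequentially. 0 \<le> Linf2_norm \<Omega> ((\<Sum>m<N. \<zeta> m) - \<xi>)"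
      by (intro always_eventually allI Linf2_norm_nonneg Linf2I[OF diff_meas diff_ae tail_nonneg])
    show "\<forall>\<^sub>F N in sequentially. Linf2_norm \<Omega> ((\<Sum>m<N. \<zeta> m) - \<xi>) \<le> (\<Sum>m. b (m + N))"
      by (intro always_eventually allI Linf2_norm_le[OF diff_meas diff_ae tail_nonneg])
  qed
  with \<xi> show ?thesis by blast
qed

subsection \<open>Integration against the kernel\<close>

text \<open>Compactness bounds the values, so that the supremum of reals is a genuine upper
  bound.\<close>

lemma abs_le_sup_norm:
  assumes "compact X" "f \<in> Cont X" "p \<in> X"
  shows "\<bar>f p\<bar> \<le> sup_norm X f"
proof -
  have "compact ((\<lambda>p. \<bar>f p\<bar>) ` X)"
    using assms by (intro compact_continuous_image continuous_intros) (auto simp: Cont_def)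
  then show ?thesis
    unfolding sup_norm_def using assms(3)
    by (intro cSUP_upper) (auto intro: bounded_imp_bdd_above compact_imp_bounded)
qed

lemma sup_norm_le:
  assumes "X \<noteq> {}" "\<And>p. p \<in> X \<Longrightarrow> \<bar>f p\<bar> \<le> c"
  shows "sup_norm X f \<le> c"
  unfolding sup_norm_def using assms by (intro cSUP_least)

text \<open>This is \<mu> without the factor \<open>k\<^sup>2\<close>.\<close>

definition kernel_bound :: "'a::euclidean_space set \<Rightarrow> ('a \<Rightarrow> 'a \<Rightarrow> real) \<Rightarrow> real" where
  "kernel_bound \<Omega> G = (SUP x\<in>\<Omega>. LINT y|lebesgue_on \<Omega>. \<bar>G x y\<bar>)"

lemma kernel_bound_nonneg:
  assumes "admissible_kernel \<Omega> G" "\<Omega> \<noteq> {}"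
  shows "0 \<le> kernel_bound \<Omega> G"
proof -
  obtain x where "x \<in> \<Omega>" using assms(2) by blast
  then have "(LINT y|lebesgue_on \<Omega>. \<bar>G x y\<bar>) \<le> kernel_bound \<Omega> G"
    using assms(1) unfolding kernel_bound_def admissible_kernel_def by (intro cSUP_upper) auto
  moreover have "0 \<le> (LINT y|lebesgue_on \<Omega>. \<bar>G x y\<bar>)" by simp
  ultimately show ?thesis by linarith
qed

lemma integrable_kernel_mult:
  assumes "admissible_kernel \<Omega> G" "f \<in> Linf \<Omega>" "x \<in> closure \<Omega>"
  shows "integrable (lebesgue_on \<Omega>) (\<lambda>y. G x y * f y)"
proof (rule Bochner_Integration.integrable_bound)
  show "integrable (lebesgue_on \<Omega>) (\<lambda>y. G x y * Linf_norm \<Omega> f)"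
    using assms by (auto simp: admissible_kernel_def)
  show "(\<lambda>y. G x y * f y) \<in> borel_measurable (lebesgue_on \<Omega>)"
    using assms by (auto simp: admissible_kernel_def Linf_def)
  show "AE y in lebesgue_on \<Omega>. norm (G x y * f y) \<le> norm (G x y * Linf_norm \<Omega> f)"
    using AE_abs_le_Linf_norm[OF assms(2)]
    by eventually_elim (auto simp: abs_mult intro!: mult_left_mono)
qed

text \<open>Only \<open>x \<in> \<Omega>\<close> enters \<open>kernel_bound\<close>; continuity extends the estimate to the closure.\<close>

lemma abs_kernel_integral_le:
  assumes adm: "admissible_kernel \<Omega> G" and f: "f \<in> Linf \<Omega>" "Linf_norm \<Omega> f \<le> c" and x: "x \<in> closure \<Omega>"
  shows "\<bar>LINT y|lebesgue_on \<Omega>. G x y * f y\<bar> \<le> kernel_bound \<Omega> G * c"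
proof -
  have c: "0 \<le> c" using Linf_norm_nonneg[OF f(1)] f(2) by linarith
  have le: "\<bar>LINT y|lebesgue_on \<Omega>. G z y * f y\<bar> \<le> kernel_bound \<Omega> G * c" if z: "z \<in> \<Omega>" for z
  proof -
    have z': "z \<in> closure \<Omega>" using z closure_subset by blast
    have int: "integrable (lebesgue_on \<Omega>) (\<lambda>y. G z y * f y)"
      by (rule integrable_kernel_mult[OF adm f(1) z'])
    have Gz: "integrable (lebesgue_on \<Omega>) (G z)"
      using adm z' by (simp add: admissible_kernel_def)
    have "\<bar>LINT y|lebesgue_on \<Omega>. G z y * f y\<bar> \<le> (LINT y|lebesgue_on \<Omega>. \<bar>G z y * f y\<bar>)"
      by (rule integral_abs_bound)
    also have "\<dots> \<le> (LINT y|lebesgue_on \<Omega>. \<bar>G z y\<bar> * c)"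
    proof (rule integral_mono_AE)
      show "AE y in lebesgue_on \<Omega>. \<bar>G z y * f y\<bar> \<le> \<bar>G z y\<bar> * c"
        using AE_abs_le_Linf_norm[OF f(1)]
        by eventually_elim (use f(2) in \<open>auto simp: abs_mult intro!: mult_left_mono\<close>)
    qed (use int Gz in auto)
    also have "\<dots> = (LINT y|lebesgue_on \<Omega>. \<bar>G z y\<bar>) * c"
      by simp
    also have "\<dots> \<le> kernel_bound \<Omega> G * c"
      using c adm z unfolding kernel_bound_def admissible_kernel_def
      by (intro mult_right_mono cSUP_upper) auto
    finally show ?thesis .
  qed
  have "norm (LINT y|lebesgue_on \<Omega>. G x y * f y) \<le> kernel_bound \<Omega> G * c"
    using adm f le x
    by (intro continuous_on_closure_norm_le[of \<Omega> "\<lambda>x. LINT y|lebesgue_on \<Omega>. G x y * f y"])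
       (auto simp: admissible_kernel_def)
  then show ?thesis by simp
qed

lemma
  assumes \<Omega>: "open \<Omega>" and f: "f \<in> Linf \<Omega>" and v: "continuous_on \<Omega> v"
    and bd: "\<And>y. y \<in> \<Omega> \<Longrightarrow> \<bar>v y\<bar> \<le> V" "0 \<le> V"
  shows mult_in_Linf: "(\<lambda>y. f y * v y) \<in> Linf \<Omega>"
    and Linf_norm_mult_le: "Linf_norm \<Omega> (\<lambda>y. f y * v y) \<le> Linf_norm \<Omega> f * V"
proof -
  have "v \<in> borel_measurable (lebesgue_on \<Omega>)"
    using \<Omega> v by (intro continuous_imp_measurable_on_sets_lebesgue) auto
  then have m: "(\<lambda>y. f y * v y) \<in> borel_measurable (lebesgue_on \<Omega>)"
    using f by (auto simp: Linf_def)
  \<comment> \<open>The bound on \<open>v\<close> is known only on \<Omega>, which carries the whole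
    measure.\<close>
  have "AE y in lebesgue_on \<Omega>. y \<in> \<Omega>"
    using AE_space[of "lebesgue_on \<Omega>"] by (rule AE_mp) simp
  then have ae: "AE y in lebesgue_on \<Omega>. \<bar>f y * v y\<bar> \<le> Linf_norm \<Omega> f * V"
    using AE_abs_le_Linf_norm[OF f]
    by eventually_elim (use bd in \<open>auto simp: abs_mult intro!: mult_mono\<close>)
  have "0 \<le> Linf_norm \<Omega> f * V"
    using bd(2) Linf_norm_nonneg[OF f] by simp
  then show "(\<lambda>y. f y * v y) \<in> Linf \<Omega>" "Linf_norm \<Omega> (\<lambda>y. f y * v y) \<le> Linf_norm \<Omega> f * V"
    using m ae by (auto intro: LinfI Linf_norm_le)
qed

lemma Cont_field_domD:
  assumes "v \<in> Cont (field_dom \<Omega>)" "s \<in> frontier \<Omega>"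
  shows "continuous_on \<Omega> (\<lambda>y. v (y, s))"
proof (rule continuous_on_compose2[where f="\<lambda>y. (y, s)"])
  show "continuous_on (field_dom \<Omega>) v"
    using assms(1) by (simp add: Cont_def)
  show "continuous_on \<Omega> (\<lambda>y. (y, s))"
    by (intro continuous_intros)
  show "(\<lambda>y. (y, s)) ` \<Omega> \<subseteq> field_dom \<Omega>"
    using assms(2) closure_subset[of \<Omega>] by auto
qed

lemma abs_kernel_op_le:
  assumes adm: "admissible_kernel \<Omega> G" and \<Omega>: "open \<Omega>" and f: "f \<in> Linf \<Omega>"
    and v: "v \<in> Cont (field_dom \<Omega>)" and bd: "\<And>p. p \<in> field_dom \<Omega> \<Longrightarrow> \<bar>v p\<bar> \<le> V"
    and xs: "x \<in> closure \<Omega>" "s \<in> frontier \<Omega>"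
  shows "\<bar>LINT y|lebesgue_on \<Omega>. G x y * f y * v (y, s)\<bar> \<le> kernel_bound \<Omega> G * (Linf_norm \<Omega> f * V)"
proof -
  have "0 \<le> V" using bd[of "(x, s)"] xs by auto
  moreover have "\<bar>v (y, s)\<bar> \<le> V" if "y \<in> \<Omega>" for y
    using bd[of "(y, s)"] xs(2) that closure_subset[of \<Omega>] by auto
  ultimately have "\<bar>LINT y|lebesgue_on \<Omega>. G x y * (f y * v (y, s))\<bar> \<le> kernel_bound \<Omega> G * (Linf_norm \<Omega> f * V)"
    using adm \<Omega> f v xs
    by (intro abs_kernel_integral_le mult_in_Linf[where V=V] Linf_norm_mult_le Cont_field_domD)
  then show ?thesis by (simp add: mult.assoc)
qed

text \<open>Joint continuity combines two facts. For fixed \<open>s\<close> the integral is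
  continuous in \<open>x\<close> by admissibility of the kernel; in \<open>s\<close> it is
  continuous uniformly in \<open>x\<close>, because \<open>v\<close> is uniformly continuous on a
  compact set.\<close>

lemma kernel_op_in_Cont:
  assumes adm: "admissible_kernel \<Omega> G" and \<Omega>: "open \<Omega>" "bounded \<Omega>" and f: "f \<in> Linf \<Omega>"
    and v: "v \<in> Cont (field_dom \<Omega>)"
  shows "(\<lambda>(x, s). LINT y|lebesgue_on \<Omega>. G x y * f y * v (y, s)) \<in> Cont (field_dom \<Omega>)"
proof (cases "\<Omega> = {}")
  case False
  \<comment> \<open>The summand 1 makes \<open>B\<close> positive, so that the tolerance
    \<open>e / (2 * B)\<close> below makes sense.\<close>
  define B where "B = kernel_bound \<Omega> G * Linf_norm \<Omega> f + 1"
  define I where "I = (\<lambda>x s. LINT y|lebesgue_on \<Omega>. G x y * f y * v (y, s))"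
  have B: "B > 0"
    using mult_nonneg_nonneg[OF kernel_bound_nonneg[OF adm False] Linf_norm_nonneg[OF f]]
    by (simp add: B_def)
  have comp: "compact (field_dom \<Omega>)"
    using \<Omega>(2) by (simp add: compact_Times compact_closure compact_frontier_bounded)
  have section_Linf: "(\<lambda>y. f y * v (y, s)) \<in> Linf \<Omega>" if s: "s \<in> frontier \<Omega>" for s
  proof (rule mult_in_Linf[OF \<Omega>(1) f Cont_field_domD[OF v s]])
    show "\<bar>v (y, s)\<bar> \<le> \<bar>sup_norm (field_dom \<Omega>) v\<bar>" if "y \<in> \<Omega>" for y
    proof -
      have "(y, s) \<in> field_dom \<Omega>" using that s closure_subset[of \<Omega>] by auto
      from abs_le_sup_norm[OF comp v this] show ?thesis by linarith
    qed
  qed auto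
  have cont_x: "continuous_on (closure \<Omega>) (\<lambda>x. I x s)" if "s \<in> frontier \<Omega>" for s
    using adm section_Linf[OF that] by (auto simp: admissible_kernel_def I_def mult.assoc)
  \<comment> \<open>By linearity the difference is the integral against
    \<open>v (y, s) - v (y, s')\<close>; the bound does not depend on \<open>x\<close>.\<close>
  have lip: "\<bar>I x s - I x s'\<bar> \<le> B * d"
    if "x \<in> closure \<Omega>" "s \<in> frontier \<Omega>" "s' \<in> frontier \<Omega>"
      and d: "\<And>y. y \<in> \<Omega> \<Longrightarrow> \<bar>v (y, s) - v (y, s')\<bar> \<le> d" for x s s' d
  proof -
    obtain y0 where "y0 \<in> \<Omega>" using False by blast
    then have d0: "0 \<le> d" using d[of y0] by linarith
    have *: "I x s - I x s' = (LINT y|lebesgue_on \<Omega>. G x y * (f y * (v (y, s) - v (y, s'))))"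
      using integrable_kernel_mult[OF adm section_Linf[OF that(2)] that(1)]
        integrable_kernel_mult[OF adm section_Linf[OF that(3)] that(1)]
      by (simp add: I_def right_diff_distrib mult.assoc)
    have "\<bar>I x s - I x s'\<bar> \<le> kernel_bound \<Omega> G * (Linf_norm \<Omega> f * d)"
      unfolding * using adm \<Omega> f v that d d0
      by (intro abs_kernel_integral_le mult_in_Linf[where V=d] Linf_norm_mult_le continuous_intros Cont_field_domD)
    also have "\<dots> \<le> B * d"
      using d0 by (simp add: B_def algebra_simps)
    finally show ?thesis .
  qed
  have "continuous_on (field_dom \<Omega>) (\<lambda>(x, s). I x s)"
    unfolding continuous_on_iff
  proof (intro ballI allI impI)
    fix p and e :: real assume p: "p \<in> field_dom \<Omega>" and e: "e > 0"
    obtain x0 s0 where p0: "p = (x0, s0)" by (cases p)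
    have xs0: "x0 \<in> closure \<Omega>" "s0 \<in> frontier \<Omega>" using p p0 by auto
    obtain d1 where d1: "d1 > 0" "\<And>x. x \<in> closure \<Omega> \<Longrightarrow> dist x x0 < d1 \<Longrightarrow> dist (I x s0) (I x0 s0) < e / 2"
      using cont_x[OF xs0(2)] xs0(1) e unfolding continuous_on_iff by (meson half_gt_zero)
    have "uniformly_continuous_on (field_dom \<Omega>) v"
      using v comp by (intro compact_uniformly_continuous) (auto simp: Cont_def)
    moreover have "e / (2 * B) > 0" using e B by simp
    ultimately obtain d2 where d2: "d2 > 0"
      "\<And>q q'. q \<in> field_dom \<Omega> \<Longrightarrow> q' \<in> field_dom \<Omega> \<Longrightarrow> dist q' q < d2 \<Longrightarrow> dist (v q') (v q) < e / (2 * B)"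
      unfolding uniformly_continuous_on_def by metis
    show "\<exists>d>0. \<forall>q\<in>field_dom \<Omega>. dist q p < d \<longrightarrow>
        dist (case q of (x, s) \<Rightarrow> I x s) (case p of (x, s) \<Rightarrow> I x s) < e"
    proof (intro exI[of _ "min d1 d2"] conjI ballI impI)
      fix q assume q: "q \<in> field_dom \<Omega>" "dist q p < min d1 d2"
      obtain x s where qs: "q = (x, s)" by (cases q)
      have xs: "x \<in> closure \<Omega>" "s \<in> frontier \<Omega>" using q qs by auto
      have dx: "dist x x0 < d1" and ds: "dist s s0 < d2"
        using q(2) dist_fst_le[of q p] dist_snd_le[of q p] by (auto simp: qs p0)
      have "\<bar>v (y, s) - v (y, s0)\<bar> \<le> e / (2 * B)" if "y \<in> \<Omega>" for y
        using d2(2)[of "(y, s0)" "(y, s)"] that xs xs0 ds closure_subset[of \<Omega>]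
        by (auto simp: dist_Pair_Pair dist_real_def subset_iff less_imp_le)
      then have "\<bar>I x s - I x s0\<bar> \<le> B * (e / (2 * B))"
        by (intro lip xs xs0)
      moreover have "B * (e / (2 * B)) = e / 2" using B by simp
      moreover have "\<bar>I x s0 - I x0 s0\<bar> < e / 2"
        using d1(2)[OF xs(1) dx] by (simp add: dist_real_def)
      ultimately show "dist (case q of (x, s) \<Rightarrow> I x s) (case p of (x, s) \<Rightarrow> I x s) < e"
        unfolding qs p0 dist_real_def prod.case by linarith
    qed (use d1 d2 in auto)
  qed
  then show ?thesis by (simp add: Cont_def I_def)
qed (simp add: Cont_def)

subsection \<open>Bounds for the forward operators\<close>

text \<open>Both maps are the same integral operator, with the first or the second component of
  \<zeta> as coefficient; either component has norm at most \<open>Linf2_norm\<close>.\<close>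

lemma
  assumes adm: "admissible_kernel \<Omega> G" and \<Omega>: "open \<Omega>" "bounded \<Omega>" "\<Omega> \<noteq> {}"
    and \<zeta>: "\<zeta> \<in> Linf2 \<Omega>" and v: "v \<in> Cont (field_dom \<Omega>)"
  shows a_map_in_Cont: "a_map k \<Omega> G v \<zeta> \<in> Cont (field_dom \<Omega>)"
    and b_map_in_Cont: "b_map k \<Omega> G v \<zeta> \<in> Cont (field_dom \<Omega>)"
    and abs_a_map_le: "\<lbrakk>\<And>p. p \<in> field_dom \<Omega> \<Longrightarrow> \<bar>v p\<bar> \<le> V; p \<in> field_dom \<Omega>\<rbrakk>
      \<Longrightarrow> \<bar>a_map k \<Omega> G v \<zeta> p\<bar> \<le> k\<^sup>2 * kernel_bound \<Omega> G * (Linf2_norm \<Omega> \<zeta> * V)"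
    and abs_b_map_le: "\<lbrakk>\<And>p. p \<in> field_dom \<Omega> \<Longrightarrow> \<bar>v p\<bar> \<le> V; p \<in> field_dom \<Omega>\<rbrakk>
      \<Longrightarrow> \<bar>b_map k \<Omega> G v \<zeta> p\<bar> \<le> k\<^sup>2 * kernel_bound \<Omega> G * (Linf2_norm \<Omega> \<zeta> * V)"
proof -
  have cont: "(\<lambda>(x, s). - k\<^sup>2 * (LINT y|lebesgue_on \<Omega>. G x y * f y * v (y, s))) \<in> Cont (field_dom \<Omega>)"
    if "f \<in> Linf \<Omega>" for f
  proof -
    have "continuous_on (field_dom \<Omega>)
        (\<lambda>p. - k\<^sup>2 * (\<lambda>(x, s). LINT y|lebesgue_on \<Omega>. G x y * f y * v (y, s)) p)"
      using kernel_op_in_Cont[OF adm \<Omega>(1,2) that v]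
      by (intro continuous_on_mult_left) (simp add: Cont_def)
    then show ?thesis by (simp add: Cont_def case_prod_beta')
  qed
  have le: "\<bar>- k\<^sup>2 * (LINT y|lebesgue_on \<Omega>. G x y * f y * v (y, s))\<bar>
      \<le> k\<^sup>2 * kernel_bound \<Omega> G * (Linf2_norm \<Omega> \<zeta> * V)"
    if "\<And>p. p \<in> field_dom \<Omega> \<Longrightarrow> \<bar>v p\<bar> \<le> V" "x \<in> closure \<Omega>" "s \<in> frontier \<Omega>"
      "f \<in> Linf \<Omega>" "Linf_norm \<Omega> f \<le> Linf2_norm \<Omega> \<zeta>" for x s f V
  proof -
    have V: "0 \<le> V" using that(1)[of "(x, s)"] that(2,3) by auto
    have "\<bar>LINT y|lebesgue_on \<Omega>. G x y * f y * v (y, s)\<bar> \<le> kernel_bound \<Omega> G * (Linf_norm \<Omega> f * V)"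
      by (rule abs_kernel_op_le[OF adm \<Omega>(1) that(4) v that(1-3)])
    also have "\<dots> \<le> kernel_bound \<Omega> G * (Linf2_norm \<Omega> \<zeta> * V)"
      using that(5) V kernel_bound_nonneg[OF adm \<Omega>(3)] by (intro mult_left_mono mult_right_mono)
    finally have "k\<^sup>2 * \<bar>LINT y|lebesgue_on \<Omega>. G x y * f y * v (y, s)\<bar>
        \<le> k\<^sup>2 * (kernel_bound \<Omega> G * (Linf2_norm \<Omega> \<zeta> * V))"
      by (rule mult_left_mono) simp
    then show ?thesis
      by (simp add: abs_mult mult.assoc)
  qed
  have \<zeta>': "fst \<zeta> \<in> Linf \<Omega>" "snd \<zeta> \<in> Linf \<Omega>"
    using \<zeta> by auto
  show "a_map k \<Omega> G v \<zeta> \<in> Cont (field_dom \<Omega>)" "b_map k \<Omega> G v \<zeta> \<in> Cont (field_dom \<Omega>)"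
    unfolding a_map_def b_map_def using cont \<zeta>' by auto
  show "\<bar>a_map k \<Omega> G v \<zeta> p\<bar> \<le> k\<^sup>2 * kernel_bound \<Omega> G * (Linf2_norm \<Omega> \<zeta> * V)"
    if "\<And>p. p \<in> field_dom \<Omega> \<Longrightarrow> \<bar>v p\<bar> \<le> V" "p \<in> field_dom \<Omega>"
    using le[OF that(1), of "fst p" "snd p" "fst \<zeta>"] that(2) \<zeta>'
    by (auto simp: a_map_def case_prod_beta' Linf2_norm_def)
  show "\<bar>b_map k \<Omega> G v \<zeta> p\<bar> \<le> k\<^sup>2 * kernel_bound \<Omega> G * (Linf2_norm \<Omega> \<zeta> * V)"
    if "\<And>p. p \<in> field_dom \<Omega> \<Longrightarrow> \<bar>v p\<bar> \<le> V" "p \<in> field_dom \<Omega>"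
    using le[OF that(1), of "fst p" "snd p" "snd \<zeta>"] that(2) \<zeta>'
    by (auto simp: b_map_def case_prod_beta' Linf2_norm_def)
qed

lemma bound_seq_nonneg: "0 \<le> c \<Longrightarrow> 0 \<le> bound_seq c n"
proof (induction n rule: less_induct)
  case (less n)
  show ?case
  proof (cases n)
    case (Suc m)
    have "0 \<le> bound_seq c i" if "i \<le> m" for i
      using less.IH[of i] less.prems that Suc by simp
    then show ?thesis
      unfolding Suc by (auto intro!: add_nonneg_nonneg sum_nonneg mult_nonneg_nonneg simp: triples_def)
  qed (use less in simp)
qed

text \<open>Strong induction, since the recursion for order \<open>Suc m\<close> involves all orders
  up to \<open>m\<close>. Continuity and bound are proved together, because the estimates for
  \<open>a_map\<close> and \<open>b_map\<close> require a continuous field.\<close>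

lemma
  assumes adm: "admissible_kernel \<Omega> G" and \<Omega>: "open \<Omega>" "bounded \<Omega>" "\<Omega> \<noteq> {}"
    and u: "u \<in> Cont (field_dom \<Omega>)" and u_le: "\<And>p. p \<in> field_dom \<Omega> \<Longrightarrow> \<bar>u p\<bar> \<le> c" "0 \<le> c"
    and \<mu>: "\<mu> = k\<^sup>2 * kernel_bound \<Omega> G"
    and \<zeta>s: "length \<zeta>s = n" "set \<zeta>s \<subseteq> Linf2 \<Omega>"
  shows forward_op_in_Cont: "forward_op k \<Omega> G u n \<zeta>s \<in> Cont (field_dom \<Omega>)"
    and abs_forward_op_le: "p \<in> field_dom \<Omega> \<Longrightarrow>
      \<bar>forward_op k \<Omega> G u n \<zeta>s p\<bar> \<le> bound_seq c n * \<mu> ^ n * prod_list (map (Linf2_norm \<Omega>) \<zeta>s)"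
proof -
  define F where "F = forward_op k \<Omega> G u"
  define w where "w = (\<lambda>\<zeta>s. prod_list (map (Linf2_norm \<Omega>) \<zeta>s))"
  have \<mu>0: "0 \<le> \<mu>"
    using kernel_bound_nonneg[OF adm \<Omega>(3)] by (simp add: \<mu>)
  have w0: "0 \<le> w \<eta>s" if "set \<eta>s \<subseteq> Linf2 \<Omega>" for \<eta>s
    using that unfolding w_def by (induction \<eta>s) (auto intro!: mult_nonneg_nonneg Linf2_norm_nonneg)
  have "F n \<zeta>s \<in> Cont (field_dom \<Omega>) \<and> (\<forall>p\<in>field_dom \<Omega>. \<bar>F n \<zeta>s p\<bar> \<le> bound_seq c n * \<mu> ^ n * w \<zeta>s)"
    using \<zeta>s
  proof (induction n arbitrary: \<zeta>s rule: less_induct)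
    case (less n)
    show ?case
    proof (cases n)
      case 0
      then show ?thesis using u u_le less.prems by (simp add: F_def w_def)
    next
      case (Suc m)
      then obtain \<eta>s \<zeta> where \<zeta>s: "\<zeta>s = \<eta>s @ [\<zeta>]"
        using less.prems(1) by (metis length_Suc_conv_rev)
      have \<eta>s: "length \<eta>s = m" "set \<eta>s \<subseteq> Linf2 \<Omega>" and \<zeta>: "\<zeta> \<in> Linf2 \<Omega>"
        using less.prems Suc \<zeta>s by auto
      have IH: "F i \<xi>s \<in> Cont (field_dom \<Omega>)"
        "\<And>p. p \<in> field_dom \<Omega> \<Longrightarrow> \<bar>F i \<xi>s p\<bar> \<le> bound_seq c i * \<mu> ^ i * w \<xi>s"
        if "i \<le> m" "length \<xi>s = i" "set \<xi>s \<subseteq> Linf2 \<Omega>" for i \<xi>s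
        using less.IH[of i \<xi>s] that Suc by auto
      \<comment> \<open>The value at \<open>\<eta>s\<close> of the nested tensor product for one
        triple: the first tensor splits after \<open>i1 + i2\<close> arguments, the inner one after
        \<open>i1\<close>.\<close>
      define P where "P = (\<lambda>(i1, i2, i3::nat) p. F i1 (take i1 (take (i1 + i2) \<eta>s)) p *
        F i2 (drop i1 (take (i1 + i2) \<eta>s)) p * F i3 (drop (i1 + i2) \<eta>s) p)"
      define q where "q = (\<lambda>(i1, i2, i3). bound_seq c i1 * bound_seq c i2 * bound_seq c i3)"
      have P: "P t \<in> Cont (field_dom \<Omega>) \<and> (\<forall>p\<in>field_dom \<Omega>. \<bar>P t p\<bar> \<le> q t * (\<mu> ^ m * w \<eta>s))"
        if t: "t \<in> triples m" for t
      proof -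
        obtain i1 i2 i3 where t': "t = (i1, i2, i3)" by (cases t)
        with t have m: "m = i1 + i2 + i3" by (simp add: triples_def)
        define \<xi>1 \<xi>2 \<xi>3 where \<xi>_def: "\<xi>1 = take i1 (take (i1 + i2) \<eta>s)"
          "\<xi>2 = drop i1 (take (i1 + i2) \<eta>s)" "\<xi>3 = drop (i1 + i2) \<eta>s"
        have split: "\<eta>s = \<xi>1 @ \<xi>2 @ \<xi>3"
          unfolding \<xi>_def append_assoc[symmetric] append_take_drop_id by simp
        have len: "length \<xi>1 = i1" "length \<xi>2 = i2" "length \<xi>3 = i3"
          using \<eta>s(1) m by (auto simp: \<xi>_def)
        have set: "set \<xi>1 \<subseteq> Linf2 \<Omega>" "set \<xi>2 \<subseteq> Linf2 \<Omega>" "set \<xi>3 \<subseteq> Linf2 \<Omega>"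
          using \<eta>s(2) split by auto
        have i: "i1 \<le> m" "i2 \<le> m" "i3 \<le> m" using m by auto
        note IH1 = IH[OF i(1) len(1) set(1)] and IH2 = IH[OF i(2) len(2) set(2)]
          and IH3 = IH[OF i(3) len(3) set(3)]
        have P_eq: "P t p = F i1 \<xi>1 p * F i2 \<xi>2 p * F i3 \<xi>3 p" for p
          by (simp add: P_def t' \<xi>_def)
        \<comment> \<open>Since the exponents of \<mu> also add up to \<open>m\<close>, every triple
          yields the same factor \<open>\<mu> ^ m * w \<eta>s\<close>, and only \<open>q t\<close>
          depends on the triple.\<close>
        have w_eq: "w \<eta>s = w \<xi>1 * w \<xi>2 * w \<xi>3"
          by (subst split) (simp add: w_def)
        have nonneg: "0 \<le> bound_seq c i1 * \<mu> ^ i1 * w \<xi>1" "0 \<le> bound_seq c i2 * \<mu> ^ i2 * w \<xi>2"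
          using bound_seq_nonneg[OF u_le(2)] \<mu>0 w0 set by simp_all
        have "P t \<in> Cont (field_dom \<Omega>)"
          using IH1(1) IH2(1) IH3(1) unfolding Cont_def mem_Collect_eq P_eq[abs_def]
          by (intro continuous_on_mult)
        moreover have "\<bar>P t p\<bar> \<le> q t * (\<mu> ^ m * w \<eta>s)" if p: "p \<in> field_dom \<Omega>" for p
        proof -
          have "\<bar>P t p\<bar> = \<bar>F i1 \<xi>1 p\<bar> * \<bar>F i2 \<xi>2 p\<bar> * \<bar>F i3 \<xi>3 p\<bar>"
            by (simp add: P_eq abs_mult)
          also have "\<dots> \<le> (bound_seq c i1 * \<mu> ^ i1 * w \<xi>1) * (bound_seq c i2 * \<mu> ^ i2 * w \<xi>2)
              * (bound_seq c i3 * \<mu> ^ i3 * w \<xi>3)"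
            using IH1(2)[OF p] IH2(2)[OF p] IH3(2)[OF p] nonneg
            by (intro mult_mono mult_nonneg_nonneg[OF nonneg] mult_nonneg_nonneg[OF abs_ge_zero abs_ge_zero] abs_ge_zero)
          also have "\<dots> = q t * (\<mu> ^ m * w \<eta>s)"
            by (simp add: q_def t' m w_eq power_add algebra_simps)
          finally show ?thesis .
        qed
        ultimately show ?thesis by blast
      qed
      define S where "S = (\<lambda>p. \<Sum>t\<in>triples m. P t p)"
      have S: "S \<in> Cont (field_dom \<Omega>)"
        using P unfolding Cont_def S_def mem_Collect_eq by (intro continuous_on_sum) auto
      have S_le: "\<bar>S p\<bar> \<le> (\<Sum>t\<in>triples m. q t) * (\<mu> ^ m * w \<eta>s)" if "p \<in> field_dom \<Omega>" for p
        unfolding S_def sum_distrib_right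
        by (rule order_trans[OF sum_abs]) (use P that in \<open>auto intro!: sum_mono\<close>)
      have F_eq: "F (Suc m) \<zeta>s = (\<lambda>p. a_map k \<Omega> G (F m \<eta>s) \<zeta> p + b_map k \<Omega> G S \<zeta> p)"
      proof -
        have "(\<Sum>(i1, i2, i3)\<in>triples m. tensor (i1 + i2) (tensor i1 (F i1) (F i2)) (F i3)) \<eta>s = S"
          unfolding S_def P_def
          by (auto simp: fun_eq_iff sum_fun_apply tensor_def case_prod_beta' intro!: sum.cong)
        from this[unfolded F_def] show ?thesis
          unfolding F_def forward_op.simps plus_fun_def op_A_def op_B_def \<zeta>s butlast_snoc last_snoc
          by (simp only:)
      qed
      note IHm = IH[OF order_refl \<eta>s]
      have "F (Suc m) \<zeta>s \<in> Cont (field_dom \<Omega>)"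
        using a_map_in_Cont[OF adm \<Omega> \<zeta> IHm(1), of k] b_map_in_Cont[OF adm \<Omega> \<zeta> S, of k]
        unfolding F_eq Cont_def mem_Collect_eq by (intro continuous_on_add)
      moreover have "\<bar>F (Suc m) \<zeta>s p\<bar> \<le> bound_seq c (Suc m) * \<mu> ^ Suc m * w \<zeta>s" if p: "p \<in> field_dom \<Omega>" for p
      proof -
        have "\<bar>F (Suc m) \<zeta>s p\<bar> \<le> \<mu> * (Linf2_norm \<Omega> \<zeta> * (bound_seq c m * \<mu> ^ m * w \<eta>s))
            + \<mu> * (Linf2_norm \<Omega> \<zeta> * ((\<Sum>t\<in>triples m. q t) * (\<mu> ^ m * w \<eta>s)))"
          using abs_a_map_le[OF adm \<Omega> \<zeta> IHm(1) IHm(2) p, of k]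
            abs_b_map_le[OF adm \<Omega> \<zeta> S S_le p, of k] abs_triangle_ineq
          unfolding F_eq \<mu>[symmetric] by (meson add_mono order_trans)
        \<comment> \<open>The two summands are the two parts of the recursion of
          \<open>bound_seq\<close>; the new argument contributes one \<mu> and one norm.\<close>
        also have "\<dots> = bound_seq c (Suc m) * \<mu> ^ Suc m * w \<zeta>s"
          by (simp add: \<zeta>s w_def q_def algebra_simps)
        finally show ?thesis .
      qed
      ultimately show ?thesis using Suc by blast
    qed
  qed
  then show "forward_op k \<Omega> G u n \<zeta>s \<in> Cont (field_dom \<Omega>)"
    and "p \<in> field_dom \<Omega> \<Longrightarrow> \<bar>forward_op k \<Omega> G u n \<zeta>s p\<bar>
      \<le> bound_seq c n * \<mu> ^ n * prod_list (map (Linf2_norm \<Omega>) \<zeta>s)"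
    by (auto simp: F_def w_def)
qed

subsection \<open>Recursive inequalities over compositions\<close>

text \<open>Multiplying out the power of a sum gives one term per word of length \<open>n\<close>
  over \<open>A\<close>; the induction peels off the head of the word.\<close>

lemma sum_prod_list_lists_length:
  fixes b :: "'i \<Rightarrow> 'b::comm_semiring_1"
  shows "(\<Sum>xs | set xs \<subseteq> A \<and> length xs = n. prod_list (map b xs)) = (\<Sum>i\<in>A. b i) ^ n"
proof (induction n)
  case 0
  have "{xs. set xs \<subseteq> A \<and> length xs = 0} = {[]}" by auto
  then show ?case by simp
next
  case (Suc n)
  have "(\<Sum>xs | set xs \<subseteq> A \<and> length xs = Suc n. prod_list (map b xs)) =
      (\<Sum>(xs, i)\<in>{xs. set xs \<subseteq> A \<and> length xs = n} \<times> A. b i * prod_list (map b xs))"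
    unfolding lists_length_Suc_eq by (subst sum.reindex) (auto simp: inj_on_def case_prod_beta')
  also have "\<dots> = (\<Sum>i\<in>A. b i) ^ Suc n"
    unfolding sum.cartesian_product[symmetric]
    by (simp add: Suc[symmetric] sum_distrib_right sum_distrib_left mult.commute)
  finally show ?case .
qed

lemma finite_compositions: "finite (compositions n m)"
proof (rule finite_subset)
  show "compositions n m \<subseteq> {xs. set xs \<subseteq> {..m} \<and> length xs = n}"
    using member_le_sum_list by (auto simp: compositions_def)
qed (simp add: finite_lists_length_eq)

text \<open>With at least two positive parts, every part is smaller than \<open>m\<close>, hence at
  most \<open>N\<close>. So compositions of the various \<open>m\<close> are distinct words of
  length \<open>n\<close> over \<open>{1..N}\<close>, and the sum over all such words is the power
  on the right.\<close>

lemma sum_compositions_le: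
  fixes b :: "nat \<Rightarrow> real"
  assumes b: "\<And>i. 0 \<le> b i" and n: "2 \<le> n"
  shows "(\<Sum>m=2..Suc N. \<Sum>is\<in>compositions n m. prod_list (map b is)) \<le> (\<Sum>i=1..N. b i) ^ n"
proof -
  have nonneg: "0 \<le> prod_list (map b is)" for "is"
    using b by (induction "is") auto
  have "(\<Sum>m=2..Suc N. \<Sum>is\<in>compositions n m. prod_list (map b is)) =
      (\<Sum>is\<in>(\<Union>m\<in>{2..Suc N}. compositions n m). prod_list (map b is))"
    by (rule sum.UNION_disjoint[symmetric]) (auto simp: finite_compositions, auto simp: compositions_def)
  also have "\<dots> \<le> (\<Sum>is | set is \<subseteq> {1..N} \<and> length is = n. prod_list (map b is))"
  proof (rule sum_mono2)
    show "(\<Union>m\<in>{2..Suc N}. compositions n m) \<subseteq> {is. set is \<subseteq> {1..N} \<and> length is = n}"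
      using compositions_less[OF _ n] by (fastforce simp: compositions_def)
  qed (auto simp: nonneg finite_lists_length_eq)
  also have "\<dots> = (\<Sum>i=1..N. b i) ^ n"
    by (rule sum_prod_list_lists_length)
  finally show ?thesis .
qed

lemma sum_power_from_2_le:
  fixes t :: real
  assumes "0 \<le> t" "t < 1"
  shows "(\<Sum>n=2..N. t ^ n) \<le> t\<^sup>2 / (1 - t)"
proof -
  have "(1 - t) * (\<Sum>n=2..N. t ^ n) \<le> t\<^sup>2"
  proof (cases N)
    case (Suc N')
    \<comment> \<open>Telescoping. The case \<open>N' = 0\<close> is the empty sum, where both sides
      vanish.\<close>
    have "(1 - t) * (\<Sum>n=2..Suc N'. t ^ n) = t\<^sup>2 - t ^ (N' + 2)"
    proof (induction N')
      case (Suc i)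
      have "(\<Sum>n=2..Suc (Suc i). t ^ n) = (\<Sum>n=2..Suc i. t ^ n) + t ^ (i + 2)"
        by (subst sum.cl_ivl_Suc) simp
      with Suc show ?case by (simp add: distrib_left left_diff_distrib)
    qed (simp add: power2_eq_square)
    then show ?thesis using assms Suc by simp
  qed simp
  then show ?thesis using assms by (simp add: field_simps)
qed

text \<open>Summing the recursion over \<open>m \<le> N\<close> gives \<open>s\<^sub>N \<le> b\<^sub>1 + M \<Sum>\<^sub>n (c s\<^sub>N\<^sub>-\<^sub>1)\<^sup>n\<close>
  for the partial sums \<open>s\<^sub>N\<close>, which preserves the bound \<open>s\<^sub>N \<le> 2 b\<^sub>1\<close>.\<close>

lemma composition_recursion_bounded:
  fixes b :: "nat \<Rightarrow> real"
  assumes b: "\<And>i. 0 \<le> b i" and M: "0 \<le> M" and c: "0 \<le> c"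
    and rec: "\<And>m. 2 \<le> m \<Longrightarrow>
      b m \<le> M * (\<Sum>n=2..m. c ^ n * (\<Sum>is\<in>compositions n m. prod_list (map b is)))"
    and small: "c * b 1 * (4 * (M * c) + 2) \<le> 1" "2 * (c * b 1) < 1"
  shows "(\<Sum>i=1..N. b i) \<le> 2 * b 1"
proof (induction N)
  case (Suc N)
  define s where "s = (\<Sum>i=1..N. b i)"
  \<comment> \<open>The induction hypothesis \<open>s \<le> 2 * b 1\<close> says exactly that
    \<open>t\<close> dominates \<open>c * s\<close>.\<close>
  define t where "t = 2 * (c * b 1)"
  have s: "0 \<le> s" "c * s \<le> t"
    using b Suc.IH mult_left_mono[OF Suc.IH c] by (auto simp: s_def t_def intro: sum_nonneg)
  have t: "0 \<le> t" "t < 1"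
    using b[of 1] c small(2) by (auto simp: t_def)
  have nonneg: "0 \<le> prod_list (map b is)" for "is"
    using b by (induction "is") auto
  have "(\<Sum>m=2..Suc N. b m)
      \<le> (\<Sum>m=2..Suc N. M * (\<Sum>n=2..Suc N. c ^ n * (\<Sum>is\<in>compositions n m. prod_list (map b is))))"
  proof (rule sum_mono)
    fix m assume m: "m \<in> {2..Suc N}"
    then have "b m \<le> M * (\<Sum>n=2..m. c ^ n * (\<Sum>is\<in>compositions n m. prod_list (map b is)))"
      by (intro rec) simp
    \<comment> \<open>Making the range of \<open>n\<close> independent of \<open>m\<close>, by
      adding nonnegative terms, allows the two sums to be exchanged.\<close>
    also have "\<dots> \<le> M * (\<Sum>n=2..Suc N. c ^ n * (\<Sum>is\<in>compositions n m. prod_list (map b is)))"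
      using m c M nonneg by (intro mult_left_mono sum_mono2) (auto intro!: sum_nonneg mult_nonneg_nonneg)
    finally show "b m \<le> M * (\<Sum>n=2..Suc N. c ^ n * (\<Sum>is\<in>compositions n m. prod_list (map b is)))" .
  qed
  also have "\<dots> = M * (\<Sum>n=2..Suc N. c ^ n * (\<Sum>m=2..Suc N. \<Sum>is\<in>compositions n m. prod_list (map b is)))"
    unfolding sum_distrib_left by (rule sum.swap)
  also have "\<dots> \<le> M * (\<Sum>n=2..Suc N. t ^ n)"
  proof (intro mult_left_mono[OF _ M] sum_mono)
    fix n assume n: "n \<in> {2..Suc N}"
    have "c ^ n * (\<Sum>m=2..Suc N. \<Sum>is\<in>compositions n m. prod_list (map b is)) \<le> c ^ n * s ^ n"
      using n c unfolding s_def by (intro mult_left_mono sum_compositions_le b) auto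
    also have "\<dots> \<le> t ^ n"
      using s c by (simp add: power_mult_distrib[symmetric] power_mono)
    finally show "c ^ n * (\<Sum>m=2..Suc N. \<Sum>is\<in>compositions n m. prod_list (map b is)) \<le> t ^ n" .
  qed
  also have "\<dots> \<le> M * (t\<^sup>2 / (1 - t))"
    by (intro mult_left_mono M sum_power_from_2_le t)
  \<comment> \<open>After multiplication by \<open>1 - t\<close> this reads \<open>4 * M * c\<^sup>2
    * (b 1)\<^sup>2 \<le> b 1 * (1 - 2 * c * b 1)\<close>, which is the first smallness condition
    times \<open>b 1\<close>.\<close>
  also have "\<dots> \<le> b 1"
  proof -
    have "M * t\<^sup>2 = b 1 * (4 * (M * c) * (c * b 1))"
      by (simp add: t_def power2_eq_square)
    also have "\<dots> \<le> b 1 * (1 - t)"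
      using small(1) by (intro mult_left_mono b) (simp add: t_def algebra_simps)
    finally show ?thesis using t by (simp add: pos_divide_le_eq)
  qed
  finally have "(\<Sum>m=2..Suc N. b m) \<le> b 1" .
  moreover have "(\<Sum>i=1..Suc N. b i) = b 1 + (\<Sum>m=2..Suc N. b m)"
    by (subst sum.atLeast_Suc_atMost) (simp_all add: numeral_2_eq_2)
  ultimately show ?case by linarith
qed (use b[of 1] in simp)

subsection \<open>The inverse series\<close>

text \<open>Boundedness makes the supremum of quotients finite. Where the sup norm vanishes, the
  quotient is 0 by convention and carries no information; there the estimate comes from boundedness
  itself.\<close>

lemma
  assumes L: "bounded_linear_data_op \<Omega> L" and \<Omega>: "bounded \<Omega>" "frontier \<Omega> \<noteq> {}"
  shows data_op_norm_nonneg: "0 \<le> data_op_norm \<Omega> L"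
    and Linf2_norm_data_op_le: "\<psi> \<in> Cont (data_dom \<Omega>) \<Longrightarrow>
      Linf2_norm \<Omega> (L \<psi>) \<le> data_op_norm \<Omega> L * sup_norm (data_dom \<Omega>) \<psi>"
proof -
  define q where "q = (\<lambda>\<psi>. Linf2_norm \<Omega> (L \<psi>) / sup_norm (data_dom \<Omega>) \<psi>)"
  have comp: "compact (data_dom \<Omega>)"
    using \<Omega>(1) by (simp add: compact_Times compact_frontier_bounded)
  have sup_norm_nonneg: "0 \<le> sup_norm (data_dom \<Omega>) \<psi>" if \<psi>: "\<psi> \<in> Cont (data_dom \<Omega>)" for \<psi>
  proof -
    obtain p where "p \<in> data_dom \<Omega>" using \<Omega>(2) by blast
    from abs_le_sup_norm[OF comp \<psi> this] show ?thesis by linarith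
  qed
  obtain M where M: "\<And>\<psi>. \<psi> \<in> Cont (data_dom \<Omega>) \<Longrightarrow> Linf2_norm \<Omega> (L \<psi>) \<le> M * sup_norm (data_dom \<Omega>) \<psi>"
    using L unfolding bounded_linear_data_op_def by meson
  have "q \<psi> \<le> \<bar>M\<bar>" if \<psi>: "\<psi> \<in> Cont (data_dom \<Omega>)" for \<psi>
  proof (cases "sup_norm (data_dom \<Omega>) \<psi> = 0")
    case False
    then have "q \<psi> \<le> M"
      using M[OF \<psi>] sup_norm_nonneg[OF \<psi>] by (simp add: q_def pos_divide_le_eq)
    then show ?thesis by linarith
  qed (simp add: q_def)
  then have q: "q \<psi> \<le> data_op_norm \<Omega> L" if "\<psi> \<in> Cont (data_dom \<Omega>)" for \<psi>
    unfolding data_op_norm_def q_def[symmetric] using that by (intro cSUP_upper bdd_aboveI2) auto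
  have "(\<lambda>_. 0) \<in> Cont (data_dom \<Omega>)" by (simp add: Cont_def)
  moreover have "q (\<lambda>_. 0) = 0"
    using \<Omega>(2) by (simp add: q_def sup_norm_def)
  ultimately show "0 \<le> data_op_norm \<Omega> L"
    using q by fastforce
  show "Linf2_norm \<Omega> (L \<psi>) \<le> data_op_norm \<Omega> L * sup_norm (data_dom \<Omega>) \<psi>"
    if \<psi>: "\<psi> \<in> Cont (data_dom \<Omega>)"
  proof (cases "sup_norm (data_dom \<Omega>) \<psi> = 0")
    case True
    then show ?thesis using M[OF \<psi>] by simp
  next
    case False
    then show ?thesis
      using q[OF \<psi>] sup_norm_nonneg[OF \<psi>] by (simp add: q_def pos_divide_le_eq)
  qed
qed

text \<open>Stated for an arbitrary family \<open>\<zeta>\<close>, known only below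
  \<open>m\<close>, so that it serves both the membership induction for the inverse operators and
  the recursion of their norms.\<close>

lemma Linf2_norm_op_term_le:
  assumes F: "\<And>n \<zeta>s. length \<zeta>s = n \<Longrightarrow> set \<zeta>s \<subseteq> Linf2 \<Omega> \<Longrightarrow>
      L (F n \<zeta>s) \<in> Linf2 \<Omega> \<and> Linf2_norm \<Omega> (L (F n \<zeta>s)) \<le> M * c ^ n * prod_list (map (Linf2_norm \<Omega>) \<zeta>s)"
    and \<zeta>: "\<And>i. i < m \<Longrightarrow> \<zeta> i \<in> Linf2 \<Omega>"
  shows "(\<Sum>n=2..m. \<Sum>is\<in>compositions n m. L (F n (map \<zeta> is))) \<in> Linf2 \<Omega> \<and>
    Linf2_norm \<Omega> (\<Sum>n=2..m. \<Sum>is\<in>compositions n m. L (F n (map \<zeta> is)))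
      \<le> M * (\<Sum>n=2..m. c ^ n * (\<Sum>is\<in>compositions n m. prod_list (map (\<lambda>i. Linf2_norm \<Omega> (\<zeta> i)) is)))"
proof -
  define T where "T = (\<lambda>n. \<Sum>is\<in>compositions n m. L (F n (map \<zeta> is)))"
  define B where "B = (\<lambda>n. \<Sum>is\<in>compositions n m. M * c ^ n * prod_list (map (\<lambda>i. Linf2_norm \<Omega> (\<zeta> i)) is))"
  have single: "L (F n (map \<zeta> is)) \<in> Linf2 \<Omega> \<and> Linf2_norm \<Omega> (L (F n (map \<zeta> is)))
      \<le> M * c ^ n * prod_list (map (\<lambda>i. Linf2_norm \<Omega> (\<zeta> i)) is)"
    if n: "2 \<le> n" and "is": "is \<in> compositions n m" for n "is"
  proof -
    have "length (map \<zeta> is) = n"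
      using "is" by (simp add: compositions_def)
    moreover have "set (map \<zeta> is) \<subseteq> Linf2 \<Omega>"
      unfolding set_map using \<zeta> compositions_less[OF "is" n] by (intro image_subsetI) blast
    ultimately show ?thesis
      using F[of "map \<zeta> is" n] by (simp add: comp_def)
  qed
  have T: "T n \<in> Linf2 \<Omega>" "Linf2_norm \<Omega> (T n) \<le> B n" if "n \<in> {2..m}" for n
  proof -
    have "2 \<le> n" using that by simp
    note * = single[OF this, THEN conjunct1] single[OF this, THEN conjunct2]
    show "T n \<in> Linf2 \<Omega>" "Linf2_norm \<Omega> (T n) \<le> B n"
      unfolding T_def B_def by (rule sum_in_Linf2 Linf2_norm_sum_le; (rule finite_compositions *)?; assumption?)+
  qed
  have "sum T {2..m} \<in> Linf2 \<Omega>" "Linf2_norm \<Omega> (sum T {2..m}) \<le> sum B {2..m}"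
    by (rule sum_in_Linf2 Linf2_norm_sum_le; (rule finite_atLeastAtMost T)?; assumption?)+
  moreover have "sum B {2..m} =
      M * (\<Sum>n=2..m. c ^ n * (\<Sum>is\<in>compositions n m. prod_list (map (\<lambda>i. Linf2_norm \<Omega> (\<zeta> i)) is)))"
    by (simp add: B_def sum_distrib_left mult.assoc)
  ultimately show ?thesis
    unfolding T_def by simp
qed

lemma inverse_op_in_Linf2:
  assumes F: "\<And>n \<zeta>s. length \<zeta>s = n \<Longrightarrow> set \<zeta>s \<subseteq> Linf2 \<Omega> \<Longrightarrow>
      L (F n \<zeta>s) \<in> Linf2 \<Omega> \<and> Linf2_norm \<Omega> (L (F n \<zeta>s)) \<le> M * c ^ n * prod_list (map (Linf2_norm \<Omega>) \<zeta>s)"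
    and \<phi>: "L \<phi> \<in> Linf2 \<Omega>"
  shows "inverse_op F L m \<phi> \<in> Linf2 \<Omega>"
proof (induction m rule: less_induct)
  case (less m)
  \<comment> \<open>This is the default value of \<open>inverse_op\<close> at
    \<open>m = 0\<close>.\<close>
  have "(0 :: 'a coeff) \<in> Linf2 \<Omega>"
    by (rule Linf2I[of _ _ 0]) (auto simp: zero_fun_def)
  moreover have "- (\<Sum>n=2..m. \<Sum>is\<in>compositions n m. L (F n (map (\<lambda>i. inverse_op F L i \<phi>) is))) \<in> Linf2 \<Omega>"
    using Linf2_norm_op_term_le[OF F less.IH] by (intro uminus_in_Linf2) auto
  ultimately show ?case
    using \<phi> by (subst inverse_op.simps) auto
qed

text \<open>Supplies the recursive inequality that \<open>composition_recursion_bounded\<close>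
  requires.\<close>

lemma Linf2_norm_inverse_op_le:
  assumes F: "\<And>n \<zeta>s. length \<zeta>s = n \<Longrightarrow> set \<zeta>s \<subseteq> Linf2 \<Omega> \<Longrightarrow>
      L (F n \<zeta>s) \<in> Linf2 \<Omega> \<and> Linf2_norm \<Omega> (L (F n \<zeta>s)) \<le> M * c ^ n * prod_list (map (Linf2_norm \<Omega>) \<zeta>s)"
    and \<phi>: "L \<phi> \<in> Linf2 \<Omega>" and m: "2 \<le> m"
  shows "Linf2_norm \<Omega> (inverse_op F L m \<phi>) \<le> M * (\<Sum>n=2..m. c ^ n *
    (\<Sum>is\<in>compositions n m. prod_list (map (\<lambda>i. Linf2_norm \<Omega> (inverse_op F L i \<phi>)) is)))"
proof -
  define T where
    "T = (\<Sum>n=2..m. \<Sum>is\<in>compositions n m. L (F n (map (\<lambda>i. inverse_op F L i \<phi>) is)))"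
  have eq: "inverse_op F L m \<phi> = - T"
    using m unfolding T_def by (subst inverse_op.simps) simp
  have T: "T \<in> Linf2 \<Omega> \<and> Linf2_norm \<Omega> T \<le> M * (\<Sum>n=2..m. c ^ n *
      (\<Sum>is\<in>compositions n m. prod_list (map (\<lambda>i. Linf2_norm \<Omega> (inverse_op F L i \<phi>)) is)))"
    unfolding T_def by (rule Linf2_norm_op_term_le[OF F inverse_op_in_Linf2[OF F \<phi>]])
  show ?thesis
    unfolding eq using T[THEN conjunct2]
    by (rule order_trans[OF Linf2_norm_uminus_le[OF T[THEN conjunct1]]])
qed

text \<open>Since \<open>sqrt (16 C\<^sup>2 + 1) - 4 C = 1 / (sqrt (16 C\<^sup>2 + 1) + 4 C) \<le> 1 / (8 C)\<close>.\<close>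

lemma radius_le:
  fixes C :: real
  assumes "0 < C"
  shows "(sqrt (16 * C\<^sup>2 + 1) - 4 * C) * (8 * C) \<le> 1"
proof -
  \<comment> \<open>The square of the right-hand side is
    \<open>16 * C\<^sup>2 + 1 + 1 / (64 * C\<^sup>2)\<close>.\<close>
  have "sqrt (16 * C\<^sup>2 + 1) \<le> 4 * C + 1 / (8 * C)"
    using assms by (intro real_le_lsqrt) (auto simp: power2_eq_square field_simps)
  then show ?thesis using assms by (simp add: field_simps)
qed

theorem theorem1:
  fixes \<Omega> :: "'a::euclidean_space set"
    and k \<nu> K \<mu> C r :: real
    and G :: "'a \<Rightarrow> 'a \<Rightarrow> real"
    and g u\<^sub>0 :: "'a \<times> 'a \<Rightarrow> real"
    and K\<^sub>1_inv :: "('a \<times> 'a \<Rightarrow> real) \<Rightarrow> 'a coeff"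
    and \<phi> :: "'a \<times> 'a \<Rightarrow> real"
  assumes "DIM('a) > 2"
    and "smooth_bounded_domain \<Omega>"
    and "k > 0"
    and "neumann_green_function k \<Omega> G"
    and "admissible_kernel \<Omega> G"
    and "background_field k \<Omega> g u\<^sub>0"
    and "bounded_linear_data_op \<Omega> K\<^sub>1_inv"
    and "\<mu> = k\<^sup>2 * (SUP x\<in>\<Omega>. LINT y|lebesgue_on \<Omega>. \<bar>G x y\<bar>)"
    and "K > 0"
    and "\<And>n. bound_seq (sup_norm (field_dom \<Omega>) u\<^sub>0) n \<le> \<nu> * K ^ n"
    and "C = max 2 (data_op_norm \<Omega> K\<^sub>1_inv * \<nu> * K * \<mu>)"
    and "r = 1 / (2 * K * \<mu>) * (sqrt (16 * C\<^sup>2 + 1) - 4 * C)"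
    and "\<phi> \<in> Cont (data_dom \<Omega>)"
    and "Linf2_norm \<Omega> (K\<^sub>1_inv \<phi>) < r"
  shows "\<exists>\<zeta>\<in>Linf2 \<Omega>.
    (\<lambda>N. Linf2_norm \<Omega> ((\<Sum>m=1..N. inverse_op (forward_op k \<Omega> G u\<^sub>0) K\<^sub>1_inv m \<phi>) - \<zeta>))
      \<longlonglongrightarrow> 0"
proof -
  define c where "c = K * \<mu>"
  define M where "M = data_op_norm \<Omega> K\<^sub>1_inv * \<nu>"
  define F where "F = forward_op k \<Omega> G u\<^sub>0"
  define b where "b = (\<lambda>m. Linf2_norm \<Omega> (inverse_op F K\<^sub>1_inv m \<phi>))"
  have \<Omega>: "open \<Omega>" "bounded \<Omega>" "\<Omega> \<noteq> {}"
    using assms(2) by (auto simp: smooth_bounded_domain_def)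
  \<comment> \<open>A nonempty bounded set is not the whole space, so it has a boundary point; the
    suprema over \<open>data_dom \<Omega>\<close> are thus over a nonempty set.\<close>
  have fr: "frontier \<Omega> \<noteq> {}"
    using \<Omega> frontier_not_empty[of \<Omega>] not_bounded_UNIV by blast
  note adm = assms(5) and L = assms(7)
  have \<mu>: "\<mu> = k\<^sup>2 * kernel_bound \<Omega> G"
    by (simp add: assms(8) kernel_bound_def)
  have \<mu>0: "0 \<le> \<mu>"
    using kernel_bound_nonneg[OF adm \<Omega>(3)] by (simp add: \<mu>)
  have u: "u\<^sub>0 \<in> Cont (field_dom \<Omega>)"
    using assms(6) by (simp add: background_field_def)
  have comp: "compact (field_dom \<Omega>)"
    using \<Omega>(2) by (simp add: compact_Times compact_closure compact_frontier_bounded)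
  note u_le = abs_le_sup_norm[OF comp u]
  have u0: "0 \<le> sup_norm (field_dom \<Omega>) u\<^sub>0"
  proof -
    obtain p where "p \<in> field_dom \<Omega>"
      using fr \<Omega>(3) closure_subset[of \<Omega>] by auto
    from u_le[OF this] show ?thesis by linarith
  qed
  have \<nu>0: "0 \<le> \<nu>"
    using assms(10)[of 0] u0 by simp
  note L0 = data_op_norm_nonneg[OF L \<Omega>(2) fr]
  have M0: "0 \<le> M" and c0: "0 \<le> c"
    using L0 \<nu>0 \<mu>0 assms(9) by (auto simp: M_def c_def)
  have F: "K\<^sub>1_inv (F n \<zeta>s) \<in> Linf2 \<Omega> \<and>
      Linf2_norm \<Omega> (K\<^sub>1_inv (F n \<zeta>s)) \<le> M * c ^ n * prod_list (map (Linf2_norm \<Omega>) \<zeta>s)"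
    if \<zeta>s: "length \<zeta>s = n" "set \<zeta>s \<subseteq> Linf2 \<Omega>" for n \<zeta>s
  proof -
    define w where "w = prod_list (map (Linf2_norm \<Omega>) \<zeta>s)"
    have w0: "0 \<le> w"
      using \<zeta>s(2) unfolding w_def
      by (induction \<zeta>s arbitrary: n) (auto intro!: mult_nonneg_nonneg Linf2_norm_nonneg)
    have sub: "data_dom \<Omega> \<subseteq> field_dom \<Omega>"
      by (auto simp: frontier_def)
    have "F n \<zeta>s \<in> Cont (field_dom \<Omega>)"
      unfolding F_def by (rule forward_op_in_Cont[OF adm \<Omega> u u_le u0 \<mu> \<zeta>s])
    then have cont: "F n \<zeta>s \<in> Cont (data_dom \<Omega>)"
      using sub by (auto simp: Cont_def intro: continuous_on_subset)
    have "sup_norm (data_dom \<Omega>) (F n \<zeta>s) \<le> \<nu> * c ^ n * w"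
    proof (rule sup_norm_le)
      fix p assume "p \<in> data_dom \<Omega>"
      then have "p \<in> field_dom \<Omega>" using sub by blast
      from abs_forward_op_le[OF adm \<Omega> u u_le u0 \<mu> \<zeta>s this]
      have "\<bar>F n \<zeta>s p\<bar> \<le> bound_seq (sup_norm (field_dom \<Omega>) u\<^sub>0) n * \<mu> ^ n * w"
        by (simp add: F_def w_def)
      also have "\<dots> \<le> \<nu> * K ^ n * \<mu> ^ n * w"
        using w0 \<mu>0 assms(10) by (intro mult_right_mono) auto
      finally show "\<bar>F n \<zeta>s p\<bar> \<le> \<nu> * c ^ n * w"
        by (simp add: c_def power_mult_distrib mult.assoc)
    qed (use fr in auto)
    then have "Linf2_norm \<Omega> (K\<^sub>1_inv (F n \<zeta>s)) \<le> data_op_norm \<Omega> K\<^sub>1_inv * (\<nu> * c ^ n * w)"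
      using Linf2_norm_data_op_le[OF L \<Omega>(2) fr cont] mult_left_mono[OF _ L0] by (meson order_trans)
    then show ?thesis
      using L cont by (auto simp: bounded_linear_data_op_def M_def w_def mult.assoc)
  qed
  have \<phi>: "K\<^sub>1_inv \<phi> \<in> Linf2 \<Omega>"
    using L assms(13) by (auto simp: bounded_linear_data_op_def)
  note inv = inverse_op_in_Linf2[OF F \<phi>]
  have b0: "0 \<le> b m" for m
    unfolding b_def by (rule Linf2_norm_nonneg[OF inv])
  have b1: "b 1 < r"
    using assms(14) unfolding b_def by (subst inverse_op.simps) simp
  have C: "2 \<le> C" "M * c \<le> C"
    by (auto simp: assms(11) M_def c_def mult.assoc)
  \<comment> \<open>If \<mu> were 0, division by zero would give \<open>r = 0\<close>, contradicting
    \<open>0 \<le> b 1 < r\<close>.\<close>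
  have "c \<noteq> 0"
    using b1 b0[of 1] assms(9,12) by (auto simp: c_def)
  then have c: "0 < c" using c0 by simp
  \<comment> \<open>The definition of \<open>r\<close> gives
    \<open>2 * c * r = sqrt (16 * C\<^sup>2 + 1) - 4 * C\<close>, to which \<open>radius_le\<close>
    applies.\<close>
  have cb: "c * b 1 * (16 * C) \<le> 1"
  proof -
    have "c * b 1 * (16 * C) \<le> c * r * (16 * C)"
      using b1 c C by (intro mult_right_mono mult_left_mono) auto
    also have "\<dots> = (sqrt (16 * C\<^sup>2 + 1) - 4 * C) * (8 * C)"
      using c assms(9) by (auto simp: assms(12) c_def)
    also have "\<dots> \<le> 1"
      using C by (intro radius_le) simp
    finally show ?thesis .
  qed
  have cb0: "0 \<le> c * b 1" using c0 b0 by simp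
  \<comment> \<open>Both smallness conditions follow from \<open>cb\<close> with room to spare:
    \<open>4 * (M * c) + 2 \<le> 4 * C + 2 \<le> 16 * C\<close>, and \<open>32 \<le> 16 * C\<close>
    because \<open>2 \<le> C\<close>.\<close>
  have "c * b 1 * (4 * (M * c) + 2) \<le> c * b 1 * (16 * C)"
    using C cb0 by (intro mult_left_mono) auto
  then have small1: "c * b 1 * (4 * (M * c) + 2) \<le> 1"
    using cb by linarith
  have "c * b 1 * 32 \<le> c * b 1 * (16 * C)"
    using C cb0 by (intro mult_left_mono) auto
  then have small2: "2 * (c * b 1) < 1"
    using cb by linarith
  have rec: "b m \<le> M * (\<Sum>n=2..m. c ^ n * (\<Sum>is\<in>compositions n m. prod_list (map b is)))"
    if "2 \<le> m" for m
    unfolding b_def by (rule Linf2_norm_inverse_op_le[OF F \<phi> that])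
  \<comment> \<open>The shift by \<open>Suc\<close> turns the series starting at 1 into one starting
    at 0, as the general convergence lemma expects.\<close>
  have "(\<Sum>m<N. b (Suc m)) \<le> 2 * b 1" for N
    using composition_recursion_bounded[OF b0 M0 c0 rec small1 small2, of N]
    by (simp add: sum.atLeast1_atMost_eq)
  then have "summable (\<lambda>m. b (Suc m))"
    using b0 by (intro summableI_nonneg_bounded)
  then obtain \<xi> where "\<xi> \<in> Linf2 \<Omega>"
    "(\<lambda>N. Linf2_norm \<Omega> ((\<Sum>m<N. inverse_op F K\<^sub>1_inv (Suc m) \<phi>) - \<xi>)) \<longlonglongrightarrow> 0"
    using Linf2_series_convergent[of "\<lambda>m. inverse_op F K\<^sub>1_inv (Suc m) \<phi>" \<Omega>] inv
    unfolding b_def by blast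
  then show ?thesis
    unfolding F_def by (auto simp: sum.atLeast1_atMost_eq)
qed

end
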